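(* Let $X_1,X_2,\dots,X_n\in\mathcal A$ be a family of Boolean independent random variables, $A=[a_{i,j}]_{i,j=1}^n\in M_n(\mathbb C)$ self-adjoint and $T_n=\sum_{i,j}a_{i,j}X_iX_j$. Then the Boolean cumulants of $T_n$ are given as follows. (i) $$K_r(T_n)=\sum_{i_0,i_1,\dots,i_r\in[n]}\mathrm{Tr}(J_nE_{i_0}AE_{i_1}\cdots AE_{i_r})\sum_{\substack{\pi\in\mathcal I(2r)\\ \pi\vee\hat1_2^r=\hat1_{2r}}}K_\pi(X_{i_0},X_{i_1},X_{i_1},\dots,X_{i_{r-1}},X_{i_{r-1}},X_{i_r}).$$ (ii) If in addition the $X_i$ are identically distributed (as a variable $X$), then $$K_r(T_n)=\sum_{\pi\in\mathcal I(r+1)}\ \sum_{\ker\underline i\ge\pi}\mathrm{Tr}(J_nE_{i_0}AE_{i_1}\cdots AE_{i_r})\,K_{\hat\pi}(X)$$ (the inner sum over $\underline i=(i_0,\dots,i_r)\in[n]^{r+1}$), which can be expressed as $$K_r(T_n)=\sum_{\pi\in\mathcal I(r+1)}\mathrm{Tr}\Big(E^{\odot}_{\overline{\pi^c}}(\underbrace{J_n,A,\dots,A}_{r+1})\Big)K_{\hat\pi}(X).$$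
   Context: A noncommutative probability space is a pair $(\mathcal A,\varphi)$ with $\mathcal A$ a unital $*$-algebra and $\varphi:\mathcal A\to\mathbb C$ a normal state; random variables are self-adjoint elements. Subalgebras $(\mathcal A_i)$ are Boolean independent if $\varphi(X_1\cdots X_m)=\varphi(X_1)\cdots\varphi(X_m)$ whenever $X_j\in\mathcal A_{i(j)}$ with $i(1)\ne i(2)\ne\dots\ne i(m)$ (consecutive indices distinct); random variables are Boolean independent if the (not necessarily unital) subalgebras they generate are. $[n]=\{1,\dots,n\}$. $\mathcal I(n)$ is the lattice (under refinement) of interval partitions of $[n]$ (every block consists of consecutive integers), with maximal element $\hat1_n$ (one block). $\hat1_2^r=\{(1,2),(3,4),\dots,(2r-1,2r)\}\in\mathcal I(2r)$. Boolean cumulants $K_n:\mathcal A^n\to\mathbb C$ are the multilinear functionals defined recursively by $\varphi(X_1\cdots X_n)=\sum_{\pi\in\mathcal I(n)}K_\pi(X_1,\dots,X_n)$ with $K_\pi(X_1,\dots,X_n)=\prod_{B\in\pi}K_{|B|}(X_i:i\in B)$; $K_n(X)=K_n(X,\dots,X)$ and $K_\pi(X)=\prod_{B\in\pi}K_{|B|}(X)$. Identically distributed means all cumulants $K_r(X_i)$, $r\in\mathbb N$, do not depend on $i$; $X$ denotes a variable with these cumulants. For a multiindex $\underline i$, $\ker\underline i$ is the partition of positions given by $k\sim l\iff i_k=i_l$ (for $\underline i=(i_0,\dots,i_r)$ the positions are identified with $1,\dots,r+1$ in order); $\ker\underline i\ge\pi$ means every block of $\pi$ is contained in a block of $\ker\underline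 i$. $J_n$ is the $n\times n$ all-ones matrix; $E_i\in M_n(\mathbb C)$ is the projection onto the $i$-th unit vector. $E^{\mathcal D}$ maps a scalar matrix to its diagonal part: $E^{\mathcal D}(C)=\sum_iE_iCE_i$. $\odot$ is the Hadamard (entrywise) product. Bijection $\pi\mapsto\hat\pi$ from $\mathcal I(r+1)$ onto $\{\sigma\in\mathcal I(2r):\sigma\vee\hat1_2^r=\hat1_{2r}\}$: replace $1$ by $\{1\}$, $t$ by $\{2t-2,2t-1\}$ for $2\le t\le r$, and $r+1$ by $\{2r\}$, and let each block of $\hat\pi$ be the union of the sets replacing the elements of the corresponding block of $\pi$. For $\pi\in\mathcal I(m)$, the interval complement $\pi^c$ is the maximal noncrossing partition of $\{\bar1,\dots,\bar m\}$ such that $\pi\cup\pi^c$ is noncrossing on the ordered set $\bar1,1,\bar2,2,\dots,\bar m,m$. Explicitly, if $1=j_1<j_2<\dots<j_p$ are the first elements of the blocks of $\pi$, then $\pi^c$ has the block $(j_1,\dots,j_p)$ and all other blocks are singletons. The closure $\overline{\pi^c}$ is the largest noncrossing partition obtained from $\pi^c$ by merging singletons other than the first block: its blocks are $(j_1,\dots,j_p)$ and the nonempty sets $G_s=\{j_s+1,\dots,j_{s+1}-1\}$ for $1\le s<p$ and $G_p=\{j_p+1,\dots,m\}$. The (nested) Hadamard cumulant is $$E^\odot_{\overline{\pi^c}}(A_1,\dots,A_m)=E^{\mathcal D}\big(A_{j_1}H_1A_{j_2}H_2\cdots H_{p-1}A_{j_p}\big)H_p,\qquad H_s=E^{\mathcal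 D}\Big(\bigodot_{i\in G_s}A_i\Big),$$ with $H_s=I$ if $G_s=\emptyset$. For example, for $\pi=\{(1,2,3),(4,5,6)\}$ one gets $E^{\mathcal D}(A_1E^{\mathcal D}(A_2\odot A_3)A_4)E^{\mathcal D}(A_5\odot A_6)$. *)

theory Defs
  imports "HOL-Analysis.Analysis" "HOL-Algebra.Lattice"
begin

section \<open>Noncommutative probability spaces and Boolean independence\<close>

text \<open>
  The algebra is a whole type of class \<^class>\<open>ring_1\<close> together with its complex scalar
  multiplication and its involution. A bare unital \<open>*\<close>-algebra carries no topology, so a state is a
  positive linear functional normalised by \<open>\<phi> 1 = 1\<close>.
\<close>

locale nc_prob_space = vector_space smul
  for smul :: "complex \<Rightarrow> 'a::ring_1 \<Rightarrow> 'a" +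
  fixes star :: "'a \<Rightarrow> 'a" and \<phi> :: "'a \<Rightarrow> complex"
  assumes smul_mult_left: "smul c x * y = smul c (x * y)"
    and smul_mult_right: "x * smul c y = smul c (x * y)"
    and star_add: "star (x + y) = star x + star y"
    and star_smul: "star (smul c x) = smul (cnj c) (star x)"
    and star_mult: "star (x * y) = star y * star x"
    and star_star: "star (star x) = x"
    and state_linear: "Vector_Spaces.linear smul (*) \<phi>"
    and state_positive: "\<phi> (star x * x) \<in> \<real>\<^sub>\<ge>\<^sub>0"
    and state_one: "\<phi> 1 = 1"

text \<open>Subalgebras need not contain the unit.\<close>

definition subalgebra :: "(complex \<Rightarrow> 'a::ring_1 \<Rightarrow> 'a) \<Rightarrow> 'a set \<Rightarrow> bool" where
  "subalgebra smul B \<longleftrightarrow> module.subspace smul B \<and> (\<forall>x\<in>B. \<forall>y\<in>B. x * y \<in> B)"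

definition generated_subalgebra :: "(complex \<Rightarrow> 'a::ring_1 \<Rightarrow> 'a) \<Rightarrow> 'a set \<Rightarrow> 'a set" where
  "generated_subalgebra smul S = subalgebra smul hull S"

definition boolean_independent_sets :: "('a::monoid_mult \<Rightarrow> complex) \<Rightarrow> ('i \<Rightarrow> 'a set) \<Rightarrow> bool" where
  "boolean_independent_sets \<phi> \<A> \<longleftrightarrow>
     (\<forall>is xs. distinct_adj is \<and> list_all2 (\<lambda>i x. x \<in> \<A> i) is xs \<longrightarrow>
        \<phi> (prod_list xs) = prod_list (map \<phi> xs))"

definition boolean_independent ::
    "(complex \<Rightarrow> 'a::ring_1 \<Rightarrow> 'a) \<Rightarrow> ('a \<Rightarrow> complex) \<Rightarrow> ('i \<Rightarrow> 'a) \<Rightarrow> bool" where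
  "boolean_independent smul \<phi> X \<longleftrightarrow>
     boolean_independent_sets \<phi> (\<lambda>i. generated_subalgebra smul {X i})"


section \<open>Partitions\<close>

definition interval_partitions :: "nat \<Rightarrow> nat set set set" where
  "interval_partitions n = {\<pi>. partition_on {1..n} \<pi> \<and> (\<forall>B\<in>\<pi>. \<exists>a b. B = {a..b})}"

definition noncrossing :: "'a::linorder set set \<Rightarrow> bool" where
  "noncrossing \<pi> \<longleftrightarrow>
     \<not> (\<exists>B\<in>\<pi>. \<exists>C\<in>\<pi>. B \<noteq> C \<and> (\<exists>a\<in>B. \<exists>b\<in>C. \<exists>c\<in>B. \<exists>d\<in>C. a < b \<and> b < c \<and> c < d))"

definition noncrossing_partitions :: "nat \<Rightarrow> nat set set set" where
  "noncrossing_partitions n = {\<pi>. partition_on {1..n} \<pi> \<and> noncrossing \<pi>}"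

definition refinement_order :: "nat \<Rightarrow> nat set set set \<Rightarrow> nat set set gorder" where
  "refinement_order n P = \<lparr>carrier = P, eq = (=), le = refines {1..n}\<rparr>"

definition interval_join :: "nat \<Rightarrow> nat set set \<Rightarrow> nat set set \<Rightarrow> nat set set" where
  "interval_join n \<pi> \<sigma> = join (refinement_order n (interval_partitions n)) \<pi> \<sigma>"

definition one_partition :: "nat \<Rightarrow> nat set set" where
  "one_partition n = {{1..n}}"

definition pair_partition :: "nat \<Rightarrow> nat set set" where
  "pair_partition r = (\<lambda>k. {2 * k - 1, 2 * k}) ` {1..r}"

text \<open>
  A multiindex \<open>(i\<^sub>0, \<dots>, i\<^sub>r)\<close> is a function on \<open>{0..r}\<close>; the entry \<open>i\<^sub>k\<close> sits at position
  \<open>k + 1\<close> of \<open>{1..r+1}\<close>.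
\<close>

definition ker_partition :: "nat \<Rightarrow> (nat \<Rightarrow> 'i) \<Rightarrow> nat set set" where
  "ker_partition r i =
     {1..r+1} // {(k, l). k \<in> {1..r+1} \<and> l \<in> {1..r+1} \<and> i (k - 1) = i (l - 1)}"

definition hat_set :: "nat \<Rightarrow> nat \<Rightarrow> nat set" where
  "hat_set r t = (if t = 1 then {1} else if t = r + 1 then {2 * r} else {2 * t - 2, 2 * t - 1})"

definition hat_partition :: "nat \<Rightarrow> nat set set \<Rightarrow> nat set set" where
  "hat_partition r \<pi> = (\<lambda>B. \<Union>t\<in>B. hat_set r t) ` \<pi>"

text \<open>
  The ordered set with elements \<open>k'\<close> and \<open>k\<close> for \<open>1 \<le> k \<le> m\<close>, where \<open>k'\<close> immediately precedes \<open>k\<close>,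
  is realised as \<open>{1..2*m}\<close> via \<open>k' = 2 * k - 1\<close> and \<open>k = 2 * k\<close>. A partition of the primed elements
  is recorded as the corresponding partition of \<open>{1..m}\<close>.
\<close>

definition interleave :: "nat set set \<Rightarrow> nat set set \<Rightarrow> nat set set" where
  "interleave \<sigma> \<pi> = (\<lambda>B. (\<lambda>k. 2 * k - 1) ` B) ` \<sigma> \<union> (\<lambda>B. (\<lambda>k. 2 * k) ` B) ` \<pi>"

definition interval_complement :: "nat \<Rightarrow> nat set set \<Rightarrow> nat set set" where
  "interval_complement m \<pi> =
     (THE \<sigma>. greatest (refinement_order m (noncrossing_partitions m)) \<sigma>
        {\<sigma> \<in> noncrossing_partitions m. noncrossing (interleave \<sigma> \<pi>)})"

definition first_block :: "nat set set \<Rightarrow> nat set" where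
  "first_block \<sigma> = (THE B. B \<in> \<sigma> \<and> 1 \<in> B)"

text \<open>
  A partition arises from \<open>\<tau>\<close> by merging singletons other than the first block iff each of its
  blocks either is a block of \<open>\<tau>\<close> or is made up of such singletons of \<open>\<tau>\<close>.
\<close>

definition closure_partition :: "nat \<Rightarrow> nat set set \<Rightarrow> nat set set" where
  "closure_partition m \<tau> =
     (THE \<sigma>. greatest (refinement_order m (noncrossing_partitions m)) \<sigma>
        {\<sigma> \<in> noncrossing_partitions m.
           \<forall>B\<in>\<sigma>. B \<in> \<tau> \<or> (\<forall>k\<in>B. {k} \<in> \<tau> \<and> {k} \<noteq> first_block \<tau>)})"


section \<open>Boolean cumulants\<close>

text \<open>
  The arguments of \<open>K\<^sub>n\<close> are given as a list of length \<open>n\<close>. List positions start at 0, partitions at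
  1, so \<open>nths xs {k. Suc k \<in> B}\<close> is the list of the \<open>X\<^sub>i\<close> with \<open>i \<in> B\<close>. The recursion is the
  moment-cumulant formula \<open>moment_cumulant\<close> below, solved for the term of the one-block partition.
\<close>

function boolean_cumulant :: "('a::monoid_mult \<Rightarrow> complex) \<Rightarrow> 'a list \<Rightarrow> complex" where
  "boolean_cumulant \<phi> xs =
     \<phi> (prod_list xs) -
     (\<Sum>\<pi>\<in>interval_partitions (length xs) - {one_partition (length xs)}.
        \<Prod>B\<in>\<pi>. boolean_cumulant \<phi> (nths xs {k. Suc k \<in> B}))"
  by auto
termination
proof (relation "Wellfounded.measure (\<lambda>(\<phi>, xs). length xs)", goal_cases)
  case 1
  show ?case by simp
next
  case (2 \<phi> xs \<pi> B)
  let ?n = "length xs"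
  from 2 have part: "partition_on {1..?n} \<pi>" and ne: "\<pi> \<noteq> {{1..?n}}"
    by (auto simp: interval_partitions_def one_partition_def)
  have sub: "B \<subseteq> {1..?n}"
    using part 2(2) by (auto simp: partition_on_def)
  have "B \<noteq> {1..?n}"
  proof
    assume B: "B = {1..?n}"
    have "C = B" if "C \<in> \<pi>" for C
    proof (rule ccontr)
      assume "C \<noteq> B"
      then have "C \<inter> B = {}"
        using part that 2(2) by (auto simp: partition_on_def disjoint_def)
      moreover have "C \<subseteq> B" "C \<noteq> {}"
        using part that B by (auto simp: partition_on_def)
      ultimately show False by blast
    qed
    then show False using ne B 2(2) by blast
  qed
  with sub obtain j where j: "j \<in> {1..?n}" "j \<notin> B" by blast
  have "{i. i < ?n \<and> Suc i \<in> B} \<subset> {..<?n}"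
  proof
    show "{i. i < ?n \<and> Suc i \<in> B} \<noteq> {..<?n}"
      using j by (metis (no_types, lifting) Suc_pred' atLeastAtMost_iff lessThan_iff
          mem_Collect_eq not_less_eq_eq One_nat_def Suc_le_eq)
  qed auto
  then have "card {i. i < ?n \<and> Suc i \<in> B} < ?n"
    by (metis card_lessThan finite_lessThan psubset_card_mono)
  then show ?case by (simp add: length_nths)
qed

declare boolean_cumulant.simps [simp del]

definition cumulant_partition ::
    "('a::monoid_mult \<Rightarrow> complex) \<Rightarrow> nat set set \<Rightarrow> 'a list \<Rightarrow> complex" where
  "cumulant_partition \<phi> \<pi> xs = (\<Prod>B\<in>\<pi>. boolean_cumulant \<phi> (nths xs {k. Suc k \<in> B}))"

definition cumulant1 :: "('a::monoid_mult \<Rightarrow> complex) \<Rightarrow> nat \<Rightarrow> 'a \<Rightarrow> complex" where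
  "cumulant1 \<phi> n x = boolean_cumulant \<phi> (replicate n x)"

definition cumulant1_partition ::
    "('a::monoid_mult \<Rightarrow> complex) \<Rightarrow> nat set set \<Rightarrow> 'a \<Rightarrow> complex" where
  "cumulant1_partition \<phi> \<pi> x = (\<Prod>B\<in>\<pi>. cumulant1 \<phi> (card B) x)"

definition identically_distributed :: "('a::monoid_mult \<Rightarrow> complex) \<Rightarrow> 'a \<Rightarrow> 'a \<Rightarrow> bool" where
  "identically_distributed \<phi> x y \<longleftrightarrow> (\<forall>n\<ge>1. cumulant1 \<phi> n x = cumulant1 \<phi> n y)"

lemma moment_cumulant:
  assumes "xs \<noteq> []"
  shows "\<phi> (prod_list xs) =
    (\<Sum>\<pi>\<in>interval_partitions (length xs). cumulant_partition \<phi> \<pi> xs)"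
proof -
  let ?I = "interval_partitions (length xs)" and ?one = "one_partition (length xs)"
  have "?I \<subseteq> Pow (Pow {1..length xs})"
    by (auto simp: interval_partitions_def partition_on_def)
  then have fin: "finite ?I"
    by (rule finite_subset) simp
  have one: "?one \<in> ?I"
    using assms by (cases xs)
      (auto simp: interval_partitions_def one_partition_def partition_on_def disjoint_def)
  have all: "nths xs {k. Suc k \<in> {1..length xs}} = xs"
    by (rule nths_all) auto
  have "cumulant_partition \<phi> ?one xs = boolean_cumulant \<phi> xs"
    using all by (simp add: cumulant_partition_def one_partition_def)
  then show ?thesis
    using sum.remove[OF fin one, of "\<lambda>\<pi>. cumulant_partition \<phi> \<pi> xs"]
    by (simp add: boolean_cumulant.simps[of \<phi> xs] cumulant_partition_def)
qed


section \<open>Matrices\<close>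

text \<open>
  The index set \<open>[n]\<close> is a finite type; \<open>*\<close> on \<^typ>\<open>complex^'n^'n\<close> is entrywise, the matrix
  product is \<open>**\<close>.
\<close>

definition self_adjoint_matrix :: "complex^'n^'n \<Rightarrow> bool" where
  "self_adjoint_matrix A \<longleftrightarrow> (\<forall>i j. A $ i $ j = cnj (A $ j $ i))"

definition ones_matrix :: "complex^'n^'n" where
  "ones_matrix = (\<chi> i j. 1)"

definition unit_projection :: "'n \<Rightarrow> complex^'n^'n" where
  "unit_projection k = (\<chi> i j. if i = k \<and> j = k then 1 else 0)"

definition diagonal_expectation :: "complex^'n^'n \<Rightarrow> complex^'n^'n" where
  "diagonal_expectation C = (\<Sum>k\<in>UNIV. unit_projection k ** C ** unit_projection k)"

definition matrix_prod :: "(complex^'n^'n) list \<Rightarrow> complex^'n^'n" where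
  "matrix_prod Ms = foldr (**) Ms (mat 1)"

definition hadamard_prod :: "('i \<Rightarrow> complex^'n^'n) \<Rightarrow> 'i set \<Rightarrow> complex^'n^'n" where
  "hadamard_prod M S = (\<chi> k l. \<Prod>i\<in>S. M i $ k $ l)"

text \<open>
  Only used for \<open>\<sigma>\<close> the closure of the complement of an interval partition of \<open>{1..length As}\<close>. Then
  \<open>G s\<close>, the block of \<open>\<sigma>\<close> following \<open>j\<^sub>s\<close> if the successor of \<open>j\<^sub>s\<close> is not in the first block and
  empty otherwise, is the gap between \<open>j\<^sub>s\<close> and \<open>j\<^sub>s\<^sub>+\<^sub>1\<close> (or after \<open>j\<^sub>p\<close>). The
  subscript \<open>s\<close> runs from 0 to \<open>p - 1\<close>.
\<close>

definition hadamard_cumulant :: "nat set set \<Rightarrow> (complex^'n^'n) list \<Rightarrow> complex^'n^'n" where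
  "hadamard_cumulant \<sigma> As =
     (let A = (\<lambda>t. As ! (t - 1));
          J = first_block \<sigma>;
          j = (\<lambda>s. sorted_list_of_set J ! s);
          p = card J;
          G = (\<lambda>s. \<Union>{B \<in> \<sigma>. B \<noteq> J \<and> j s + 1 \<in> B});
          H = (\<lambda>s. if G s = {} then mat 1 else diagonal_expectation (hadamard_prod A (G s)))
      in diagonal_expectation
           (matrix_prod (concat (map (\<lambda>s. [A (j s), H s]) [0..<p - 1]) @ [A (j (p - 1))]))
         ** H (p - 1))"

definition path_weight :: "complex^'n^'n \<Rightarrow> nat \<Rightarrow> (nat \<Rightarrow> 'n) \<Rightarrow> complex" where
  "path_weight A r i =
     trace (matrix_prod (ones_matrix # unit_projection (i 0) #
       concat (map (\<lambda>k. [A, unit_projection (i k)]) [1..<r + 1])))"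

definition quadratic_form ::
    "(complex \<Rightarrow> 'a::ring_1 \<Rightarrow> 'a) \<Rightarrow> complex^'n^'n \<Rightarrow> ('n \<Rightarrow> 'a) \<Rightarrow> 'a" where
  "quadratic_form smul A X = (\<Sum>i\<in>UNIV. \<Sum>j\<in>UNIV. smul (A $ i $ j) (X i * X j))"

end

theory Submission
  imports Defs
begin

text \<open>
  An interval partition of \<open>{1..m}\<close> is the same thing as the set of its cuts, the points \<open>c\<close> with
  \<open>c\<close> and \<open>c + 1\<close> in different blocks. Every subset of \<open>{1..<m}\<close> occurs, and refinement
  becomes reverse inclusion; this makes all the partition combinatorics below a matter of subsets.
  In particular joins are intersections of cut sets, so joining with the pair partition
  \<open>(1,2),(3,4),\<dots>\<close>, whose cuts are the even numbers, gives the one-block partition exactly when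
  there are no even cuts.

  Splitting off the last block gives the basic recursion
  \<open>\<phi>(x\<^sub>1\<dots>x\<^sub>n) = \<Sum>\<^sub>k \<phi>(x\<^sub>1\<dots>x\<^sub>k) K(x\<^sub>k\<^sub>+\<^sub>1,\<dots>,x\<^sub>n)\<close>, which
  determines the cumulants. Three facts follow from it by induction on the length.
  A cumulant of products of pairs is the sum of \<open>K\<^sub>\<pi>\<close> over the partitions \<open>\<pi>\<close> without even cuts
  (\<open>boolean_cumulant_products\<close>), because grouping the partitions of the expanded word by their
  last even cut shows that both sides satisfy the same recursion. Cumulants of a sum of
  terms expand multilinearly (\<open>boolean_cumulant_replicate_sum\<close>). Mixed cumulants of Boolean
  independent variables vanish (\<open>mixed_boolean_cumulant_zero\<close>), because the moment of a word
  factorises at the beginning of its last run.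

  Expanding \<open>K\<^sub>r(T\<^sub>n)\<close> by the first two facts gives a sum over \<open>r\<close> pairs \<open>(i,j)\<close> of indices. A partition
  without even cuts keeps the second factor of each pair in the block of the first factor of the
  next pair, so by the third fact only chains of pairs survive, that is, paths
  \<open>i\<^sub>0,\<dots>,i\<^sub>r\<close>, weighted by \<open>a(i\<^sub>0,i\<^sub>1)\<dots>a(i\<^sub>r\<^sub>-\<^sub>1,i\<^sub>r)\<close>. This is part (i)
  (\<open>cumulant1_quadratic_form\<close>).

  The partitions without even cuts are the hats of the interval partitions of \<open>{1..r+1}\<close>: the cut
  \<open>c\<close> becomes \<open>2c - 1\<close>. For identically distributed variables the hat of \<open>\<pi>\<close> contributes its
  cumulant when the path is constant on the blocks of \<open>\<pi>\<close>, and nothing otherwise, which is the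
  first formula of part (ii). Finally, a path constant on blocks can change its value only at the
  cuts of \<open>\<pi>\<close>. Summing over such paths by a transfer recursion along the
  positions \<open>1,\<dots>,r+1\<close>, the steps inside a block multiply by a diagonal entry of \<open>A\<close> and the steps
  at a cut multiply by the matrix \<open>A\<close>. The matrix product inside the nested Hadamard cumulant runs
  through the same recursion one block at a time (\<open>trace_hadamard_cumulant\<close>), once the closure of
  the interval complement is known: its blocks are the set of block starts of \<open>\<pi>\<close> and what remains
  of each block of \<open>\<pi>\<close> after removing its start.
\<close>

section \<open>Interval partitions and their cut points\<close>

text \<open>
  Cuts encode interval partitions by subsets of \<open>{1..<m}\<close>, a Boolean lattice on which joins and
  sums over partitions are easy to handle.
\<close>

definition cut_points :: "nat \<Rightarrow> nat set set \<Rightarrow> nat set" where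
  "cut_points m \<pi> = {c \<in> {1..<m}. \<forall>B\<in>\<pi>. \<not> (c \<in> B \<and> Suc c \<in> B)}"

text \<open>
  The inverse of \<open>cut_points\<close>: two points are equivalent when no cut separates them, that is, when
  the same cuts lie below both.
\<close>

definition cut_partition :: "nat \<Rightarrow> nat set \<Rightarrow> nat set set" where
  "cut_partition m S = {1..m} // {(k, l). k \<in> {1..m} \<and> l \<in> {1..m} \<and> S \<inter> {..<k} = S \<inter> {..<l}}"

lemma cut_points_subset: "cut_points m \<pi> \<subseteq> {1..<m}"
  unfolding cut_points_def by blast

lemma interval_partitionsD:
  assumes "\<pi> \<in> interval_partitions m"
  shows "partition_on {1..m} \<pi>" and "B \<in> \<pi> \<Longrightarrow> \<exists>a b. B = {a..b}"
  using assms by (auto simp: interval_partitions_def)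

lemma partition_on_block_unique:
  assumes "partition_on A \<pi>" "B \<in> \<pi>" "C \<in> \<pi>" "x \<in> B" "x \<in> C"
  shows "B = C"
  using assms by (auto simp: partition_on_def disjoint_def)

lemma partition_on_obtain_block:
  assumes "partition_on A \<pi>" "x \<in> A"
  obtains B where "B \<in> \<pi>" "x \<in> B"
  using assms by (auto simp: partition_on_def)

text \<open>
  A block is an interval that contains no cut in its interior and can only be left across a cut,
  so a point outside it is separated from it by a cut at one of its two ends.
\<close>

lemma interval_block_iff:
  assumes \<pi>: "\<pi> \<in> interval_partitions m" and B: "B \<in> \<pi>" "k \<in> B"
  shows "l \<in> B \<longleftrightarrow> l \<in> {1..m} \<and> (\<forall>c\<in>cut_points m \<pi>. c < k \<longleftrightarrow> c < l)"
proof -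
  note part = interval_partitionsD(1)[OF \<pi>]
  obtain a b where ab: "B = {a..b}"
    using interval_partitionsD(2)[OF \<pi> B(1)] by blast
  have sub: "B \<subseteq> {1..m}"
    using part B by (auto simp: partition_on_def)
  have nocut: "c < a \<or> b \<le> c" if "c \<in> cut_points m \<pi>" for c
    using that B(1) ab by (force simp: cut_points_def)
  have below: "a - 1 \<in> cut_points m \<pi>" if "1 < a"
  proof -
    have "\<not> (a - 1 \<in> C \<and> Suc (a - 1) \<in> C)" if "C \<in> \<pi>" for C
    proof
      assume C: "a - 1 \<in> C \<and> Suc (a - 1) \<in> C"
      then have "a \<in> C" "a \<in> B" using \<open>1 < a\<close> B ab by auto
      then have "C = B" using partition_on_block_unique[OF part] that B by blast
      then show False using C ab \<open>1 < a\<close> by auto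
    qed
    moreover have "a \<le> m" using sub B ab by auto
    ultimately show ?thesis using that by (auto simp: cut_points_def)
  qed
  have above: "b \<in> cut_points m \<pi>" if "b < m"
  proof -
    have "\<not> (b \<in> C \<and> Suc b \<in> C)" if "C \<in> \<pi>" for C
    proof
      assume C: "b \<in> C \<and> Suc b \<in> C"
      then have "b \<in> B" using B ab by auto
      then have "C = B" using C partition_on_block_unique[OF part] that B by blast
      then show False using C ab by simp
    qed
    moreover have "1 \<le> b" using sub B ab by auto
    ultimately show ?thesis using that by (auto simp: cut_points_def)
  qed
  show ?thesis
  proof
    assume "l \<in> B"
    then show "l \<in> {1..m} \<and> (\<forall>c\<in>cut_points m \<pi>. c < k \<longleftrightarrow> c < l)"
      using sub B(2) ab by (fastforce dest: nocut)
  next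
    assume l: "l \<in> {1..m} \<and> (\<forall>c\<in>cut_points m \<pi>. c < k \<longleftrightarrow> c < l)"
    have "a \<le> l"
    proof (cases "1 < a")
      case True
      then have "a - 1 < k" using B ab by auto
      then show ?thesis using l below[OF True] by auto
    qed (use l in auto)
    moreover have "l \<le> b"
    proof (cases "b < m")
      case True
      have "\<not> b < k" using B ab by auto
      then show ?thesis using l above[OF True] by auto
    qed (use l in auto)
    ultimately show "l \<in> B" using ab by simp
  qed
qed

lemma refines_iff_cut_points:
  assumes "\<pi> \<in> interval_partitions m" "\<sigma> \<in> interval_partitions m"
  shows "refines {1..m} \<pi> \<sigma> \<longleftrightarrow> cut_points m \<sigma> \<subseteq> cut_points m \<pi>"
proof
  assume "refines {1..m} \<pi> \<sigma>"
  then show "cut_points m \<sigma> \<subseteq> cut_points m \<pi>"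
    by (fastforce simp: refines_def cut_points_def)
next
  assume sub: "cut_points m \<sigma> \<subseteq> cut_points m \<pi>"
  have "\<exists>C\<in>\<sigma>. B \<subseteq> C" if B: "B \<in> \<pi>" for B
  proof -
    note part = interval_partitionsD(1)[OF assms(1)] interval_partitionsD(1)[OF assms(2)]
    have "B \<noteq> {}" "B \<subseteq> {1..m}"
      using B part(1) by (auto simp: partition_on_def)
    then obtain k where k: "k \<in> B" "k \<in> {1..m}"
      by blast
    obtain C where C: "C \<in> \<sigma>" "k \<in> C"
      using partition_on_obtain_block[OF part(2) k(2)] .
    have "B \<subseteq> C"
      using sub unfolding subset_iff interval_block_iff[OF assms(1) B k(1)]
        interval_block_iff[OF assms(2) C] by simp
    with C show ?thesis by blast
  qed
  then show "refines {1..m} \<pi> \<sigma>"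
    using assms by (auto simp: refines_def interval_partitions_def)
qed

lemma interval_partition_eqI:
  assumes "\<pi> \<in> interval_partitions m" "\<sigma> \<in> interval_partitions m"
    and "cut_points m \<pi> = cut_points m \<sigma>"
  shows "\<pi> = \<sigma>"
  using assms by (intro refines_asym[of "{1..m}"]) (simp_all add: refines_iff_cut_points del: One_nat_def)

lemma equiv_kernel_on: "equiv A {(k, l). k \<in> A \<and> l \<in> A \<and> f k = f l}"
  by (rule equivI) (auto simp: refl_on_def sym_def trans_def)

text \<open>
  Stated for an arbitrary function \<open>f\<close>, since both \<open>cut_partition\<close> and \<open>ker_partition\<close> are kernels
  of functions.
\<close>

lemma quotient_kernel_on:
  "A // {(k, l). k \<in> A \<and> l \<in> A \<and> f k = f l} = (\<lambda>k. {l \<in> A. f k = f l}) ` A"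
  by (auto simp: quotient_def)

lemma same_block_kernel_on:
  assumes "c \<in> A" "d \<in> A"
  shows "(\<exists>B\<in>A // {(k, l). k \<in> A \<and> l \<in> A \<and> f k = f l}. c \<in> B \<and> d \<in> B) \<longleftrightarrow> f c = f d"
  using assms unfolding quotient_kernel_on by auto

lemma cut_partition_interval:
  "cut_partition m S \<in> interval_partitions m"
proof -
  let ?r = "{(k, l). k \<in> {1..m} \<and> l \<in> {1..m} \<and> S \<inter> {..<k} = S \<inter> {..<l}}"
  have "partition_on {1..m} (cut_partition m S)"
    unfolding cut_partition_def by (rule partition_on_quotient[OF equiv_kernel_on])
  moreover have "\<exists>a b. B = {a..b}" if "B \<in> cut_partition m S" for B
  proof -
    obtain k where k: "k \<in> {1..m}" and B: "B = ?r `` {k}"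
      using \<open>B \<in> cut_partition m S\<close> unfolding cut_partition_def by (rule quotientE)
    then have ne: "B \<noteq> {}" and fin: "finite B"
      by (auto intro: finite_subset[of _ "{1..m}"])
    have mem: "c \<in> B \<longleftrightarrow> c \<in> {1..m} \<and> S \<inter> {..<k} = S \<inter> {..<c}" for c
      using k by (simp add: B)
    have "c \<in> B" if "c \<in> {Min B..Max B}" for c
    proof -
      have min_max: "Min B \<in> B" "Max B \<in> B" using ne fin by auto
      have "S \<inter> {..<Min B} \<subseteq> S \<inter> {..<c}" "S \<inter> {..<c} \<subseteq> S \<inter> {..<Max B}"
        using that by auto
      then have "S \<inter> {..<k} = S \<inter> {..<c}"
        using min_max unfolding mem by blast
      moreover have "c \<in> {1..m}" using min_max that unfolding mem by simp
      ultimately show ?thesis unfolding mem by blast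
    qed
    moreover have "c \<in> {Min B..Max B}" if "c \<in> B" for c
      using fin that by simp
    ultimately have "B = {Min B..Max B}"
      by blast
    then show ?thesis by blast
  qed
  ultimately show ?thesis by (auto simp: interval_partitions_def)
qed

lemma cut_points_cut_partition:
  assumes "S \<subseteq> {1..<m}"
  shows "cut_points m (cut_partition m S) = S"
proof -
  have *: "(\<exists>B\<in>cut_partition m S. c \<in> B \<and> Suc c \<in> B) \<longleftrightarrow> c \<notin> S" if "c \<in> {1..<m}" for c
  proof -
    have c: "c \<in> {1..m}" "Suc c \<in> {1..m}" using that by auto
    have "(\<exists>B\<in>cut_partition m S. c \<in> B \<and> Suc c \<in> B) \<longleftrightarrow> S \<inter> {..<c} = S \<inter> {..<Suc c}"
      unfolding cut_partition_def by (rule same_block_kernel_on[OF c])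
    also have "\<dots> \<longleftrightarrow> c \<notin> S" unfolding lessThan_Suc by blast
    finally show ?thesis .
  qed
  show ?thesis
  proof (rule Set.set_eqI)
    fix c
    show "c \<in> cut_points m (cut_partition m S) \<longleftrightarrow> c \<in> S"
      using *[of c] assms unfolding cut_points_def by blast
  qed
qed

lemma cut_partition_cut_points:
  assumes "\<pi> \<in> interval_partitions m"
  shows "cut_partition m (cut_points m \<pi>) = \<pi>"
  by (rule interval_partition_eqI[OF cut_partition_interval assms
        cut_points_cut_partition[OF cut_points_subset]])

lemma bij_betw_cut_points: "bij_betw (cut_points m) (interval_partitions m) (Pow {1..<m})"
proof (rule bij_betw_byWitness[where f' = "cut_partition m"])
  show "\<forall>\<pi>\<in>interval_partitions m. cut_partition m (cut_points m \<pi>) = \<pi>"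
    using cut_partition_cut_points by blast
  show "\<forall>S\<in>Pow {1..<m}. cut_points m (cut_partition m S) = S"
    using cut_points_cut_partition by blast
  show "cut_points m ` interval_partitions m \<subseteq> Pow {1..<m}"
    using cut_points_subset by blast
  show "cut_partition m ` Pow {1..<m} \<subseteq> interval_partitions m"
    using cut_partition_interval by blast
qed

lemma finite_interval_partitions [simp]: "finite (interval_partitions m)"
  using bij_betw_finite[OF bij_betw_cut_points] by simp

lemma one_partition_interval: "m \<ge> 1 \<Longrightarrow> one_partition m \<in> interval_partitions m"
  by (auto simp: interval_partitions_def one_partition_def partition_on_def disjoint_def)

lemma cut_points_one_partition: "cut_points m (one_partition m) = {}"
  by (auto simp: cut_points_def one_partition_def)

text \<open>
  Cuts reverse the order, so the partition with the common cuts is the least upper bound. Since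
  \<open>join\<close> is defined by choice among least upper bounds, the existence of one is what identifies it.
\<close>

lemma cut_points_interval_join:
  assumes "\<pi> \<in> interval_partitions m" "\<sigma> \<in> interval_partitions m"
  shows "interval_join m \<pi> \<sigma> \<in> interval_partitions m"
    and "cut_points m (interval_join m \<pi> \<sigma>) = cut_points m \<pi> \<inter> cut_points m \<sigma>"
proof -
  let ?L = "refinement_order m (interval_partitions m)"
  let ?\<tau> = "cut_partition m (cut_points m \<pi> \<inter> cut_points m \<sigma>)"
  have cuts: "cut_points m ?\<tau> = cut_points m \<pi> \<inter> cut_points m \<sigma>"
    by (rule cut_points_cut_partition) (use cut_points_subset in blast)
  have le: "le ?L \<rho> \<rho>' \<longleftrightarrow> cut_points m \<rho>' \<subseteq> cut_points m \<rho>"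
    if "\<rho> \<in> interval_partitions m" "\<rho>' \<in> interval_partitions m" for \<rho> \<rho>'
    using refines_iff_cut_points[OF that] by (simp add: refinement_order_def)
  have carrier: "carrier ?L = interval_partitions m"
    by (simp add: refinement_order_def)
  have upper: "\<rho> \<in> Upper ?L {\<pi>, \<sigma>} \<longleftrightarrow>
      \<rho> \<in> interval_partitions m \<and> cut_points m \<rho> \<subseteq> cut_points m \<pi> \<inter> cut_points m \<sigma>" for \<rho>
    using assms le[of _ \<rho>] by (auto simp: Upper_def carrier)
  have least: "least ?L \<rho> (Upper ?L {\<pi>, \<sigma>}) \<longleftrightarrow>
     \<rho> \<in> interval_partitions m \<and> cut_points m \<rho> = cut_points m \<pi> \<inter> cut_points m \<sigma>" for \<rho>
  proof
    assume least: "least ?L \<rho> (Upper ?L {\<pi>, \<sigma>})"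
    then have \<rho>: "\<rho> \<in> interval_partitions m" "cut_points m \<rho> \<subseteq> cut_points m \<pi> \<inter> cut_points m \<sigma>"
      by (simp_all only: upper least_def)
    have "?\<tau> \<in> Upper ?L {\<pi>, \<sigma>}"
      unfolding upper cuts using cut_partition_interval by blast
    then have "le ?L \<rho> ?\<tau>" using least unfolding least_def by blast
    then show "\<rho> \<in> interval_partitions m \<and> cut_points m \<rho> = cut_points m \<pi> \<inter> cut_points m \<sigma>"
      using \<rho> unfolding le[OF \<rho>(1) cut_partition_interval] cuts by blast
  next
    assume \<rho>: "\<rho> \<in> interval_partitions m \<and> cut_points m \<rho> = cut_points m \<pi> \<inter> cut_points m \<sigma>"
    then have "\<forall>\<rho>'\<in>Upper ?L {\<pi>, \<sigma>}. le ?L \<rho> \<rho>'"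
      using upper le by metis
    then show "least ?L \<rho> (Upper ?L {\<pi>, \<sigma>})"
      using \<rho> upper unfolding least_def carrier by blast
  qed
  have "least ?L (interval_join m \<pi> \<sigma>) (Upper ?L {\<pi>, \<sigma>})"
    unfolding interval_join_def join_def sup_def
    by (rule someI[of _ ?\<tau>]) (use least cuts cut_partition_interval in blast)
  then show "interval_join m \<pi> \<sigma> \<in> interval_partitions m"
    and "cut_points m (interval_join m \<pi> \<sigma>) = cut_points m \<pi> \<inter> cut_points m \<sigma>"
    using least by blast+
qed

lemma pair_partition_interval: "pair_partition r \<in> interval_partitions (2 * r)"
proof -
  have "x \<in> {1..2 * r} \<Longrightarrow> \<exists>k\<in>{1..r}. x \<in> {2 * k - 1, 2 * k}" for x
    by (intro bexI[of _ "(x + 1) div 2"]) auto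
  moreover have "{2 * k - 1, 2 * k} \<subseteq> {1..2 * r}" if "k \<in> {1..r}" for k
    using that by auto
  ultimately have union: "\<Union> (pair_partition r) = {1..2 * r}"
    unfolding pair_partition_def by blast
  have "j = k" if "x \<in> {2 * j - 1, 2 * j}" "x \<in> {2 * k - 1, 2 * k}" "j \<in> {1..r}" "k \<in> {1..r}"
    for x j k :: nat
    using that by auto
  then have disjoint: "disjoint (pair_partition r)"
    unfolding pair_partition_def disjoint_def by blast
  have "\<exists>a b. {2 * k - 1, 2 * k} = {a..b}" if "k \<in> {1..r}" for k :: nat
    using that by (intro exI[of _ "2 * k - 1"] exI[of _ "2 * k"]) auto
  then have intervals: "\<forall>B\<in>pair_partition r. \<exists>a b. B = {a..b}"
    unfolding pair_partition_def by blast
  have "{} \<notin> pair_partition r"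
    unfolding pair_partition_def by blast
  with union disjoint intervals show ?thesis
    unfolding interval_partitions_def partition_on_def by blast
qed

lemma cut_points_pair_partition: "cut_points (2 * r) (pair_partition r) = {c \<in> {1..<2 * r}. even c}"
proof -
  have "(\<exists>B\<in>pair_partition r. c \<in> B \<and> Suc c \<in> B) \<longleftrightarrow> odd c" if "c \<in> {1..<2 * r}" for c
  proof
    assume "\<exists>B\<in>pair_partition r. c \<in> B \<and> Suc c \<in> B"
    then obtain k where "c \<in> {2 * k - 1, 2 * k}" "Suc c \<in> {2 * k - 1, 2 * k}"
      unfolding pair_partition_def by blast
    then have "Suc c = 2 * k" by auto
    then show "odd c" by presburger
  next
    assume "odd c"
    then obtain k where "c = 2 * k + 1" by (rule oddE)
    then show "\<exists>B\<in>pair_partition r. c \<in> B \<and> Suc c \<in> B"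
      using that by (intro bexI[of _ "{c, Suc c}"])
        (auto simp: pair_partition_def intro!: image_eqI[of _ _ "Suc k"])
  qed
  then show ?thesis unfolding cut_points_def by blast
qed

text \<open>
  The cuts of the join are the even cuts of \<open>\<pi>\<close>, and the one-block partition is the one without cuts.
\<close>

lemma interval_join_pair_partition_eq_one_iff:
  assumes "\<pi> \<in> interval_partitions (2 * r)" "r \<ge> 1"
  shows "interval_join (2 * r) \<pi> (pair_partition r) = one_partition (2 * r) \<longleftrightarrow>
    (\<forall>c\<in>cut_points (2 * r) \<pi>. odd c)"
proof -
  note join = cut_points_interval_join[OF assms(1) pair_partition_interval]
  have one: "one_partition (2 * r) \<in> interval_partitions (2 * r)"
    using assms by (intro one_partition_interval) auto
  have "interval_join (2 * r) \<pi> (pair_partition r) = one_partition (2 * r) \<longleftrightarrow>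
     cut_points (2 * r) (interval_join (2 * r) \<pi> (pair_partition r)) = {}"
    using interval_partition_eqI[OF join(1) one] by (auto simp: cut_points_one_partition)
  also have "\<dots> \<longleftrightarrow> (\<forall>c\<in>cut_points (2 * r) \<pi>. odd c)"
    using cut_points_subset[of "2 * r" \<pi>] unfolding join(2) cut_points_pair_partition by blast
  finally show ?thesis .
qed

lemma insert_last_block:
  assumes "\<rho> \<in> interval_partitions k" "k < n"
  shows "insert {k+1..n} \<rho> \<in> interval_partitions n" "{k+1..n} \<notin> \<rho>"
    "cut_points n (insert {k+1..n} \<rho>) = (if k = 0 then {} else insert k (cut_points k \<rho>))"
proof -
  note part = interval_partitionsD(1)[OF assms(1)]
  have un: "\<Union>\<rho> = {1..k}" using part by (auto simp: partition_on_def)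
  have "disjnt {k+1..n} (\<Union>\<rho>)" "{1..n} - {k+1..n} = {1..k}"
    using assms un by (auto simp: disjnt_iff)
  then have "partition_on {1..n} (insert {k+1..n} \<rho>)"
    using part assms by (auto simp: partition_on_insert)
  then show "insert {k+1..n} \<rho> \<in> interval_partitions n"
    using assms interval_partitionsD(2)[OF assms(1)] by (auto simp: interval_partitions_def)
  show "{k+1..n} \<notin> \<rho>"
    using un assms by (metis Sup_upper atLeastAtMost_iff le_refl not_less_eq_eq subsetD
        Suc_eq_plus1 Suc_leI)
  have sub: "B \<subseteq> {1..k}" if "B \<in> \<rho>" for B using un that by auto
  show "cut_points n (insert {k+1..n} \<rho>) = (if k = 0 then {} else insert k (cut_points k \<rho>))"
  proof (cases "k = 0")
    case True
    then show ?thesis by (auto simp: cut_points_def)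
  next
    case False
    have "c \<in> cut_points n (insert {k+1..n} \<rho>) \<longleftrightarrow> c = k \<or> c \<in> cut_points k \<rho>" for c
    proof (cases c k rule: linorder_cases)
      case less
      then show ?thesis using assms by (auto simp: cut_points_def)
    next
      case equal
      then show ?thesis using assms False sub by (fastforce simp: cut_points_def)
    next
      case greater
      then show ?thesis using assms by (auto simp: cut_points_def)
    qed
    then show ?thesis using False by auto
  qed
qed

text \<open>
  What remains after removing the last block \<open>{k+1..n}\<close> is an arbitrary interval partition of
  \<open>{1..k}\<close>. The last block is preferable to the first because no renumbering is needed.
\<close>

lemma sum_interval_partitions_last_block:
  assumes "n \<ge> 1"
  shows "(\<Sum>\<pi>\<in>interval_partitions n. f \<pi>) =
    (\<Sum>k<n. \<Sum>\<rho>\<in>interval_partitions k. f (insert {k+1..n} \<rho>))"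
proof -
  let ?P = "SIGMA k:{..<n}. interval_partitions k"
  let ?h = "\<lambda>(k, \<rho>). insert {k+1..n} \<rho>"
  have inj: "inj_on ?h ?P"
  proof (rule inj_onI)
    fix p q assume pq: "p \<in> ?P" "q \<in> ?P" "?h p = ?h q"
    obtain k \<rho> l \<sigma> where p: "p = (k, \<rho>)" and q: "q = (l, \<sigma>)"
      by (cases p, cases q) auto
    have *: "k < n" "\<rho> \<in> interval_partitions k" "l < n" "\<sigma> \<in> interval_partitions l"
      and eq: "insert {k+1..n} \<rho> = insert {l+1..n} \<sigma>"
      using pq by (auto simp: p q)
    have "partition_on {1..n} (insert {k+1..n} \<rho>)"
      using insert_last_block(1)[OF *(2,1)] by (rule interval_partitionsD(1))
    moreover have "{l+1..n} \<in> insert {k+1..n} \<rho>" unfolding eq by blast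
    ultimately have "{k+1..n} = {l+1..n}"
      by (rule partition_on_block_unique[where x = n, OF _ insertI1]) (use *(1,3) in simp_all)
    then have kl: "k = l" using * by (simp add: Icc_eq_Icc)
    have "insert {k+1..n} \<rho> = insert {k+1..n} \<sigma>" using eq kl by simp
    moreover have "{k+1..n} \<notin> \<rho>" "{k+1..n} \<notin> \<sigma>"
      using insert_last_block(2)[OF *(2,1)] insert_last_block(2)[OF *(4,3)] kl by simp_all
    ultimately have "\<rho> = \<sigma>"
      by (metis insert_ident)
    with kl show "p = q" by (simp add: p q)
  qed
  have surj: "?h ` ?P = interval_partitions n"
  proof
    show "?h ` ?P \<subseteq> interval_partitions n" using insert_last_block(1) by auto
    show "interval_partitions n \<subseteq> ?h ` ?P"
    proof
      fix \<pi> assume \<pi>: "\<pi> \<in> interval_partitions n"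
      note part = interval_partitionsD(1)[OF \<pi>]
      have "n \<in> {1..n}" using assms by simp
      then obtain B where B: "B \<in> \<pi>" "n \<in> B"
        using partition_on_obtain_block[OF part] by blast
      obtain a b where ab: "B = {a..b}" using interval_partitionsD(2)[OF \<pi> B(1)] by blast
      have sub: "B \<subseteq> {1..n}" using partition_onD1[OF part] B(1) by blast
      have "a \<le> n" "n \<le> b" using B(2) ab by auto
      then have "a \<in> {1..n}" "b \<in> {1..n}" using sub ab by (meson atLeastAtMost_iff le_trans order_refl subsetD)+
      then have B_eq: "B = {(a - 1) + 1..n}" and a: "a - 1 < n"
        using ab \<open>n \<le> b\<close> by auto
      have \<pi>_eq: "\<pi> = insert B (\<pi> - {B})" using B by blast
      have "disjnt B (\<Union>(\<pi> - {B}))"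
        using part B by (auto simp: partition_on_def disjoint_def disjnt_def)
      then have "partition_on ({1..n} - B) (\<pi> - {B})"
        using part \<pi>_eq partition_on_insert by metis
      moreover have "{1..n} - B = {1..a - 1}" using a by (auto simp: B_eq)
      ultimately have "\<pi> - {B} \<in> interval_partitions (a - 1)"
        using interval_partitionsD(2)[OF \<pi>] by (auto simp: interval_partitions_def)
      then show "\<pi> \<in> ?h ` ?P"
        using a \<pi>_eq B_eq by (intro image_eqI[of _ _ "(a - 1, \<pi> - {B})"]) auto
    qed
  qed
  have "(\<Sum>\<pi>\<in>interval_partitions n. f \<pi>) = (\<Sum>p\<in>?P. f (?h p))"
    unfolding surj[symmetric] by (subst sum.reindex[OF inj]) simp
  also have "\<dots> = (\<Sum>k<n. \<Sum>\<rho>\<in>interval_partitions k. f (insert {k+1..n} \<rho>))"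
    by (subst sum.Sigma) (auto simp: case_prod_unfold)
  finally show ?thesis .
qed

section \<open>Boolean cumulants and the product formula\<close>

text \<open>
  Neighbouring points of a block are exactly the neighbours not separated by a cut, and values
  propagate along an interval from neighbour to neighbour.
\<close>

lemma constant_on_blocks_iff:
  assumes "\<pi> \<in> interval_partitions m"
  shows "(\<forall>B\<in>\<pi>. \<forall>k\<in>B. \<forall>l\<in>B. f k = f l) \<longleftrightarrow>
    (\<forall>c\<in>{1..<m} - cut_points m \<pi>. f c = f (Suc c))"
proof
  assume "\<forall>B\<in>\<pi>. \<forall>k\<in>B. \<forall>l\<in>B. f k = f l"
  then show "\<forall>c\<in>{1..<m} - cut_points m \<pi>. f c = f (Suc c)"
    unfolding cut_points_def by blast
next
  assume *: "\<forall>c\<in>{1..<m} - cut_points m \<pi>. f c = f (Suc c)"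
  have "\<exists>y. \<forall>k\<in>B. f k = y" if B: "B \<in> \<pi>" for B
  proof -
    obtain a b where ab: "B = {a..b}" using interval_partitionsD(2)[OF assms B] by blast
    have sub: "B \<subseteq> {1..m}"
      using partition_onD1[OF interval_partitionsD(1)[OF assms]] B by blast
    have "f k = f a" if "a \<le> k" "k \<le> b" for k
      using that
    proof (induction k rule: dec_induct)
      case (step c)
      have "c \<in> B" "Suc c \<in> B" using step ab by simp_all
      moreover from this have "c \<in> {1..<m}" using sub by (meson Suc_le_eq atLeastAtMost_iff atLeastLessThan_iff subsetD)
      ultimately have "c \<in> {1..<m} - cut_points m \<pi>"
        using B unfolding cut_points_def by blast
      then show ?case using * step by simp
    qed simp
    then show ?thesis using ab by (metis atLeastAtMost_iff)
  qed
  then show "\<forall>B\<in>\<pi>. \<forall>k\<in>B. \<forall>l\<in>B. f k = f l" by metis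
qed

lemma nths_cong:
  assumes "\<And>i. i < length xs \<Longrightarrow> i \<in> I \<longleftrightarrow> i \<in> J"
  shows "nths xs I = nths xs J"
  unfolding nths_def using assms
  by (intro arg_cong[where f = "map fst"] filter_cong) (auto simp: set_zip)

lemma nths_take_eq:
  assumes "I \<subseteq> {..<k}"
  shows "nths (take k xs) I = nths xs I"
proof -
  have "{j. j + length (take k xs) \<in> I} = {} \<or> drop k xs = []"
    using assms by (cases "k \<le> length xs") (auto simp: subset_iff)
  then have "nths (drop k xs) {j. j + length (take k xs) \<in> I} = []"
    by auto
  then show ?thesis
    using nths_append[of "take k xs" "drop k xs" I] by simp
qed

lemma cumulant_partition_insert_last_block:
  assumes \<rho>: "\<rho> \<in> interval_partitions k" and k: "k < length xs"
  shows "cumulant_partition \<phi> (insert {k+1..length xs} \<rho>) xs =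
    cumulant_partition \<phi> \<rho> (take k xs) * boolean_cumulant \<phi> (drop k xs)"
proof -
  note part = interval_partitionsD(1)[OF \<rho>]
  have "finite \<rho>" by (rule finite_elements[OF _ part]) simp
  moreover have "nths xs {j. Suc j \<in> {k+1..length xs}} = drop k xs"
    unfolding drop_eq_nths by (rule nths_cong) auto
  moreover have "nths (take k xs) {j. Suc j \<in> B} = nths xs {j. Suc j \<in> B}" if "B \<in> \<rho>" for B
  proof -
    have "B \<subseteq> {1..k}" using partition_onD1[OF part] that by blast
    then show ?thesis by (intro nths_take_eq) auto
  qed
  ultimately show ?thesis
    using insert_last_block(2)[OF \<rho> k] unfolding cumulant_partition_def
    by (simp add: mult.commute)
qed

text \<open>
  The moment-cumulant sum restricted to partitions all of whose cuts lie in \<open>C\<close>. Two cases matter: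
  \<open>C = UNIV\<close> gives the moment, and the set of odd numbers gives the sum over the partitions whose
  join with the pair partition has one block. Both satisfy the same recursion.
\<close>

definition restricted_moment :: "('a::monoid_mult \<Rightarrow> complex) \<Rightarrow> nat set \<Rightarrow> 'a list \<Rightarrow> complex" where
  "restricted_moment \<phi> C xs =
     (\<Sum>\<pi> | \<pi> \<in> interval_partitions (length xs) \<and> cut_points (length xs) \<pi> \<subseteq> C.
        cumulant_partition \<phi> \<pi> xs)"

lemma interval_partitions_0: "interval_partitions 0 = {{}}"
  by (auto simp: interval_partitions_def partition_on_empty)

lemma restricted_moment_Nil [simp]: "restricted_moment \<phi> C [] = 1"
proof -
  have "{\<pi> \<in> interval_partitions 0. cut_points 0 \<pi> \<subseteq> C} = {{}}"
    using cut_points_subset[of 0] by (auto simp: interval_partitions_0)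
  then show ?thesis by (simp add: restricted_moment_def cumulant_partition_def)
qed

text \<open>
  The last block \<open>{k+1..n}\<close> adds the cut \<open>k\<close>, unless \<open>k = 0\<close>, where it is the whole interval.
\<close>

lemma restricted_moment_last_block:
  assumes "xs \<noteq> []"
  shows "restricted_moment \<phi> C xs =
    (\<Sum>k | k < length xs \<and> (k = 0 \<or> k \<in> C).
       restricted_moment \<phi> C (take k xs) * boolean_cumulant \<phi> (drop k xs))"
proof -
  let ?n = "length xs"
  let ?f = "\<lambda>\<pi>. if cut_points ?n \<pi> \<subseteq> C then cumulant_partition \<phi> \<pi> xs else 0"
  have n: "?n \<ge> 1" using assms by (cases xs) auto
  have "restricted_moment \<phi> C xs = (\<Sum>\<pi>\<in>interval_partitions ?n. ?f \<pi>)"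
    unfolding restricted_moment_def by (subst sum.inter_filter) auto
  also have "\<dots> = (\<Sum>k<?n. \<Sum>\<rho>\<in>interval_partitions k. ?f (insert {k+1..?n} \<rho>))"
    by (rule sum_interval_partitions_last_block[OF n])
  also have "\<dots> = (\<Sum>k<?n. if k = 0 \<or> k \<in> C then
      restricted_moment \<phi> C (take k xs) * boolean_cumulant \<phi> (drop k xs) else 0)"
  proof (rule sum.cong[OF refl])
    fix k assume "k \<in> {..<?n}"
    then have k: "k < ?n" by simp
    have f: "?f (insert {k+1..?n} \<rho>) = (if k = 0 \<or> k \<in> C then
      (if cut_points k \<rho> \<subseteq> C then cumulant_partition \<phi> \<rho> (take k xs) else 0)
        * boolean_cumulant \<phi> (drop k xs) else 0)"
      if "\<rho> \<in> interval_partitions k" for \<rho>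
    proof (cases "k = 0")
      case True
      have "cut_points k \<rho> \<subseteq> C" using cut_points_subset[of 0 \<rho>] True by simp
      with True show ?thesis
        using insert_last_block(3)[OF that k] cumulant_partition_insert_last_block[OF that k]
        by simp
    next
      case False
      then show ?thesis
        using insert_last_block(3)[OF that k] cumulant_partition_insert_last_block[OF that k]
        by simp
    qed
    have "restricted_moment \<phi> C (take k xs) =
      (\<Sum>\<rho>\<in>interval_partitions k. if cut_points k \<rho> \<subseteq> C then cumulant_partition \<phi> \<rho> (take k xs) else 0)"
      using k unfolding restricted_moment_def by (subst sum.inter_filter) auto
    then show "(\<Sum>\<rho>\<in>interval_partitions k. ?f (insert {k+1..?n} \<rho>)) =
      (if k = 0 \<or> k \<in> C then restricted_moment \<phi> C (take k xs) * boolean_cumulant \<phi> (drop k xs) else 0)"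
      using f by (simp add: sum_distrib_right cong: sum.cong)
  qed
  also have "\<dots> = (\<Sum>k | k < ?n \<and> (k = 0 \<or> k \<in> C).
       restricted_moment \<phi> C (take k xs) * boolean_cumulant \<phi> (drop k xs))"
    by (subst sum.inter_filter[symmetric]) simp_all
  finally show ?thesis .
qed

lemma restricted_moment_UNIV:
  assumes "\<phi> 1 = 1"
  shows "restricted_moment \<phi> UNIV xs = \<phi> (prod_list xs)"
proof (cases "xs = []")
  case False
  then show ?thesis using moment_cumulant[of xs \<phi>] by (simp add: restricted_moment_def)
qed (simp add: assms)

lemma moment_last_block:
  assumes "\<phi> 1 = 1" and "xs \<noteq> []"
  shows "\<phi> (prod_list xs) =
    (\<Sum>k<length xs. \<phi> (prod_list (take k xs)) * boolean_cumulant \<phi> (drop k xs))"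
  using restricted_moment_last_block[OF assms(2), of \<phi> UNIV]
  by (simp add: restricted_moment_UNIV assms(1) lessThan_def)

text \<open>
  Every interval partition is uniquely cut at its last even cut \<open>k\<close> (or at \<open>k = 0\<close>) into an arbitrary
  partition of the first \<open>k\<close> points and a partition of the rest without even cuts; as \<open>k\<close> is even,
  the shift by \<open>k\<close> does not change parities. The proof runs through the last-block recursion
  instead of constructing this bijection.
\<close>

lemma restricted_moment_even_split:
  assumes "xs \<noteq> []"
  shows "restricted_moment \<phi> UNIV xs =
    (\<Sum>k | k < length xs \<and> even k.
       restricted_moment \<phi> UNIV (take k xs) * restricted_moment \<phi> {c. odd c} (drop k xs))"
  using assms
proof (induction xs rule: length_induct)
  case (1 xs)
  let ?M = "restricted_moment \<phi> UNIV" and ?D = "restricted_moment \<phi> {c. odd c}"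
    and ?K = "boolean_cumulant \<phi>" and ?n = "length xs"
  \<comment> \<open>Last-block recursion for the suffix, with its cut \<open>l\<close> renumbered as \<open>j = k + l\<close> in the whole list.\<close>
  have inner: "?D (drop k xs) =
      (\<Sum>j<?n. if k \<le> j \<and> (j = k \<or> odd j) then ?D (drop k (take j xs)) * ?K (drop j xs) else 0)"
    if k: "k < ?n" "even k" for k
  proof -
    have "?D (drop k xs) = (\<Sum>l | l < ?n - k \<and> (l = 0 \<or> odd l). ?D (take l (drop k xs)) * ?K (drop (k + l) xs))"
      using k by (subst restricted_moment_last_block) (auto simp: add.commute)
    also have "\<dots> = (\<Sum>j | j < ?n \<and> k \<le> j \<and> (j = k \<or> odd j). ?D (drop k (take j xs)) * ?K (drop j xs))"
      by (rule sum.reindex_bij_witness[where i = "\<lambda>j. j - k" and j = "\<lambda>l. k + l"])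
        (use k in \<open>auto simp: drop_take\<close>)
    also have "\<dots> = (\<Sum>j<?n. if k \<le> j \<and> (j = k \<or> odd j) then ?D (drop k (take j xs)) * ?K (drop j xs) else 0)"
      by (subst sum.inter_filter[symmetric]) simp_all
    finally show ?thesis .
  qed
  \<comment> \<open>For even \<open>j\<close> only \<open>k = j\<close> contributes; for odd \<open>j\<close> this is the induction hypothesis.\<close>
  have outer: "?M (take j xs) = (\<Sum>k | k < ?n \<and> even k. if k \<le> j \<and> (j = k \<or> odd j)
      then ?M (take k xs) * ?D (drop k (take j xs)) else 0)" if j: "j < ?n" for j
  proof (cases "even j")
    case True
    then have "(\<Sum>k | k < ?n \<and> even k. if k \<le> j \<and> (j = k \<or> odd j)
        then ?M (take k xs) * ?D (drop k (take j xs)) else 0) =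
      (\<Sum>k | k < ?n \<and> even k. if k = j then ?M (take j xs) else 0)"
      by (intro sum.cong) auto
    also have "\<dots> = ?M (take j xs)" using True j by (simp add: sum.delta)
    finally show ?thesis by simp
  next
    case False
    then have "take j xs \<noteq> []" using j by (cases j) auto
    with 1 j have "?M (take j xs) = (\<Sum>k | k < length (take j xs) \<and> even k.
        ?M (take k (take j xs)) * ?D (drop k (take j xs)))"
      by auto
    also have "\<dots> = (\<Sum>k | k < j \<and> even k. ?M (take k xs) * ?D (drop k (take j xs)))"
      using j by (intro sum.cong) auto
    also have "\<dots> = (\<Sum>k | k < ?n \<and> even k. if k \<le> j \<and> (j = k \<or> odd j)
        then ?M (take k xs) * ?D (drop k (take j xs)) else 0)"
      using False j by (intro sum.mono_neutral_cong_left) (auto simp: le_less)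
    finally show ?thesis .
  qed
  have "(\<Sum>k | k < ?n \<and> even k. ?M (take k xs) * ?D (drop k xs)) =
    (\<Sum>k | k < ?n \<and> even k. \<Sum>j<?n. (if k \<le> j \<and> (j = k \<or> odd j)
      then ?M (take k xs) * ?D (drop k (take j xs)) else 0) * ?K (drop j xs))"
    by (intro sum.cong refl) (auto simp: inner sum_distrib_left intro!: sum.cong)
  also have "\<dots> = (\<Sum>j<?n. ?M (take j xs) * ?K (drop j xs))"
    by (subst sum.swap, rule sum.cong) (simp_all add: outer sum_distrib_right)
  also have "\<dots> = ?M xs"
    using restricted_moment_last_block[OF 1(2), of \<phi> UNIV] by (simp add: lessThan_def)
  finally show ?case by simp
qed

definition flatten_pairs :: "('a \<times> 'a) list \<Rightarrow> 'a list" where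
  "flatten_pairs ps = concat (map (\<lambda>(x, y). [x, y]) ps)"

lemma flatten_pairs_simps [simp]:
  "flatten_pairs [] = []" "flatten_pairs ((x, y) # ps) = x # y # flatten_pairs ps"
  "length (flatten_pairs ps) = 2 * length ps"
  by (auto simp: flatten_pairs_def length_concat sum_list_triv case_prod_unfold comp_def)

lemma take_flatten_pairs: "take (2 * k) (flatten_pairs ps) = flatten_pairs (take k ps)"
proof (induction k arbitrary: ps)
  case (Suc k)
  then show ?case by (cases ps) auto
qed simp

lemma drop_flatten_pairs: "drop (2 * k) (flatten_pairs ps) = flatten_pairs (drop k ps)"
proof (induction k arbitrary: ps)
  case (Suc k)
  then show ?case by (cases ps) auto
qed simp

lemma prod_list_flatten_pairs:
  "prod_list (flatten_pairs ps) = prod_list (map (\<lambda>(x, y). x * y) ps :: 'a::monoid_mult list)"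
  by (induction ps) (auto simp: mult.assoc)

text \<open>
  The product formula. Splitting the moment of the expanded word at its last even cut and the
  moment of the word of products at its last block gives the same recursion for the two
  sides, with the same initial factors.
\<close>

lemma boolean_cumulant_products:
  fixes ps :: "('a::monoid_mult \<times> 'a) list"
  assumes "\<phi> 1 = 1" and "ps \<noteq> []"
  shows "boolean_cumulant \<phi> (map (\<lambda>(x, y). x * y) ps) =
    restricted_moment \<phi> {c. odd c} (flatten_pairs ps)"
  using assms(2)
proof (induction ps rule: length_induct)
  case (1 ps)
  let ?y = "map (\<lambda>(x, y). x * y)" and ?z = "flatten_pairs"
  let ?K = "boolean_cumulant \<phi>" and ?D = "restricted_moment \<phi> {c. odd c}" and ?r = "length ps"
  define m where "m k = \<phi> (prod_list (?y (take k ps)))" for k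
  have r: "?r > 0" using 1 by simp
  have "\<phi> (prod_list (?y ps)) = (\<Sum>k<?r. m k * ?K (?y (drop k ps)))"
    using moment_last_block[of \<phi> "?y ps"] assms 1 by (simp add: m_def take_map drop_map)
  moreover have "\<phi> (prod_list (?y ps)) = (\<Sum>k<?r. m k * ?D (?z (drop k ps)))"
  proof -
    have "?z ps \<noteq> []" using r by (metis flatten_pairs_simps(3) length_0_conv less_irrefl mult_eq_0_iff zero_neq_numeral)
    then have "\<phi> (prod_list (?z ps)) = (\<Sum>k | k < 2 * ?r \<and> even k.
        \<phi> (prod_list (take k (?z ps))) * ?D (drop k (?z ps)))"
      using restricted_moment_even_split[of "?z ps" \<phi>] assms by (simp add: restricted_moment_UNIV)
    also have "\<dots> = (\<Sum>k<?r. \<phi> (prod_list (take (2 * k) (?z ps))) * ?D (drop (2 * k) (?z ps)))"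
      by (rule sum.reindex_bij_witness[where i = "\<lambda>k. 2 * k" and j = "\<lambda>k. k div 2"]) auto
    finally show ?thesis
      by (simp add: m_def take_flatten_pairs drop_flatten_pairs prod_list_flatten_pairs)
  qed
  moreover have "(\<Sum>k=1..<?r. m k * ?K (?y (drop k ps))) = (\<Sum>k=1..<?r. m k * ?D (?z (drop k ps)))"
    using 1 by (intro sum.cong) auto
  moreover have "m 0 = 1" by (simp add: m_def assms)
  moreover have "(\<Sum>k<?r. g k) = g 0 + (\<Sum>k=1..<?r. g k)" for g :: "nat \<Rightarrow> complex"
    using r by (simp add: lessThan_atLeast0 sum.atLeast_Suc_lessThan)
  ultimately show ?case by simp
qed

section \<open>Multilinearity and mixed cumulants\<close>

lemma finite_lists_length [simp]: "finite {es :: 'e::finite list. length es = r}"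
  using finite_lists_length_eq[of "UNIV :: 'e set" r] by simp

lemma sum_lists_length_Suc:
  fixes f :: "'e::finite list \<Rightarrow> 'b::comm_monoid_add"
  shows "(\<Sum>es | length es = Suc r. f es) = (\<Sum>e\<in>UNIV. \<Sum>es | length es = r. f (e # es))"
proof -
  have "(\<Sum>es | length es = Suc r. f es) =
      (\<Sum>(e, es)\<in>UNIV \<times> {es. length es = r}. f (e # es))"
    by (rule sum.reindex_bij_witness[where i = "\<lambda>(e, es). e # es" and j = "\<lambda>es. (hd es, tl es)"])
      (auto simp: length_Suc_conv)
  then show ?thesis by (simp add: sum.cartesian_product)
qed

lemma sum_lists_length_add:
  fixes f g :: "'e::finite list \<Rightarrow> complex"
  shows "(\<Sum>es | length es = k + l. f (take k es) * g (drop k es)) =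
    (\<Sum>es | length es = k. f es) * (\<Sum>es | length es = l. g es)"
proof (induction k arbitrary: f)
  case (Suc k)
  have "(\<Sum>es | length es = Suc k + l. f (take (Suc k) es) * g (drop (Suc k) es)) =
     (\<Sum>e\<in>UNIV. \<Sum>es | length es = k + l. f (e # take k es) * g (drop k es))"
    by (simp add: sum_lists_length_Suc)
  also have "\<dots> = (\<Sum>e\<in>UNIV. (\<Sum>es | length es = k. f (e # es)) * (\<Sum>es | length es = l. g es))"
    by (simp add: Suc.IH[of "\<lambda>es. f (_ # es)"])
  finally show ?case by (simp add: sum_lists_length_Suc sum_distrib_right)
qed (simp add: sum_distrib_left)

context nc_prob_space
begin

lemma \<phi>_sum: "\<phi> (sum f S) = (\<Sum>i\<in>S. \<phi> (f i))"
proof -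
  interpret L: Vector_Spaces.linear smul "(*)" \<phi> by (rule state_linear)
  show ?thesis by (rule L.sum)
qed

lemma \<phi>_smul: "\<phi> (smul c x) = c * \<phi> x"
proof -
  interpret L: Vector_Spaces.linear smul "(*)" \<phi> by (rule state_linear)
  show ?thesis by (rule L.scale)
qed

lemma prod_list_replicate_sum:
  fixes Y :: "'e::finite \<Rightarrow> 'a"
  shows "prod_list (replicate r (\<Sum>e\<in>UNIV. smul (c e) (Y e))) =
    (\<Sum>es | length es = r. smul (prod_list (map c es)) (prod_list (map Y es)))"
proof (induction r)
  case (Suc r)
  then show ?case
    by (simp add: sum_lists_length_Suc sum_product smul_mult_left smul_mult_right mult.commute
        del: prod_list_replicate)
qed simp

text \<open>
  Multilinearity of cumulants, in the form needed for the powers of one element. Both sides solve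
  the last-block recursion of the moments, which are multilinear by linearity of the state.
\<close>

lemma boolean_cumulant_replicate_sum:
  fixes Y :: "'e::finite \<Rightarrow> 'a"
  shows "boolean_cumulant \<phi> (replicate r (\<Sum>e\<in>UNIV. smul (c e) (Y e))) =
    (\<Sum>es | length es = r. prod_list (map c es) * boolean_cumulant \<phi> (map Y es))"
proof (induction r rule: less_induct)
  case (less r)
  let ?T = "\<Sum>e\<in>UNIV. smul (c e) (Y e)"
  let ?K = "boolean_cumulant \<phi>"
  let ?c = "\<lambda>es. prod_list (map c es)" and ?m = "\<lambda>es. \<phi> (prod_list (map Y es))"
  show ?case
  proof (cases "r = 0")
    case False
    have moment: "\<phi> (prod_list (replicate k ?T)) = (\<Sum>es | length es = k. ?c es * ?m es)" for k
      unfolding prod_list_replicate_sum \<phi>_sum \<phi>_smul ..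
    have "\<phi> (prod_list (replicate r ?T)) =
        (\<Sum>k<r. \<phi> (prod_list (replicate k ?T)) * ?K (replicate (r - k) ?T))"
      using moment_last_block[of \<phi> "replicate r ?T", OF state_one] False
      by (simp add: take_replicate min_def del: prod_list_replicate)
    moreover have "(\<Sum>es | length es = r. ?c es * ?m es) =
        (\<Sum>k<r. \<Sum>es | length es = r. (?c (take k es) * ?m (take k es)) * (?c (drop k es) * ?K (map Y (drop k es))))"
    proof (subst sum.swap, rule sum.cong[OF refl])
      fix es :: "'e list" assume "es \<in> {es. length es = r}"
      then have es: "map Y es \<noteq> []" "length es = r" using False by auto
      have "?c es = ?c (take k es) * ?c (drop k es)" for k
        by (metis append_take_drop_id map_append prod_list.append)
      then have "(?c (take k es) * a) * (?c (drop k es) * b) = ?c es * (a * b)" for k a b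
        by (simp add: mult_ac)
      moreover have "?m es = (\<Sum>k<r. ?m (take k es) * ?K (map Y (drop k es)))"
        using moment_last_block[of \<phi> "map Y es", OF state_one] es
        by (simp add: take_map drop_map)
      ultimately show "?c es * ?m es = (\<Sum>k<r. (?c (take k es) * ?m (take k es)) * (?c (drop k es) * ?K (map Y (drop k es))))"
        by (simp only: sum_distrib_left)
    qed
    moreover have "(\<Sum>es | length es = r. (?c (take k es) * ?m (take k es)) * (?c (drop k es) * ?K (map Y (drop k es)))) =
        \<phi> (prod_list (replicate k ?T)) * (\<Sum>es | length es = r - k. ?c es * ?K (map Y es))"
      if "k < r" for k
      using sum_lists_length_add[where k = k and l = "r - k" and f = "\<lambda>es. ?c es * ?m es" and g = "\<lambda>es. ?c es * ?K (map Y es)"] that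
      unfolding moment by simp
    ultimately have "(\<Sum>k<r. \<phi> (prod_list (replicate k ?T)) * ?K (replicate (r - k) ?T)) =
       (\<Sum>k<r. \<phi> (prod_list (replicate k ?T)) * (\<Sum>es | length es = r - k. ?c es * ?K (map Y es)))"
      unfolding moment by simp
    moreover have "(\<Sum>k=1..<r. \<phi> (prod_list (replicate k ?T)) * ?K (replicate (r - k) ?T)) =
       (\<Sum>k=1..<r. \<phi> (prod_list (replicate k ?T)) * (\<Sum>es | length es = r - k. ?c es * ?K (map Y es)))"
      using less by (intro sum.cong) auto
    moreover have "(\<Sum>k<r. g k) = g 0 + (\<Sum>k=1..<r. g k)" for g :: "nat \<Rightarrow> complex"
      using False by (simp add: lessThan_atLeast0 sum.atLeast_Suc_lessThan)
    ultimately show ?thesis by (simp add: state_one del: prod_list_replicate)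
  qed simp
qed

end

lemma generated_subalgebra_base: "x \<in> S \<Longrightarrow> x \<in> generated_subalgebra smul S"
  unfolding generated_subalgebra_def by (rule hull_inc)

lemma generated_subalgebra_mult:
  "x \<in> generated_subalgebra smul S \<Longrightarrow> y \<in> generated_subalgebra smul S \<Longrightarrow>
    x * y \<in> generated_subalgebra smul S"
  unfolding generated_subalgebra_def hull_def subalgebra_def by blast

text \<open>
  Boolean independence only speaks about words with distinct neighbours; multiplying out the runs
  of equal letters inside their subalgebras brings every word to this form.
\<close>

lemma boolean_word_runs:
  assumes "js \<noteq> []"
  shows "\<exists>ks xs. ks \<noteq> [] \<and> hd ks = hd js \<and> last ks = last js \<and> distinct_adj ks \<and>
    list_all2 (\<lambda>i x. x \<in> generated_subalgebra smul {X i}) ks xs \<and> prod_list xs = prod_list (map X js)"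
  using assms
proof (induction js)
  case (Cons j js)
  show ?case
  proof (cases "js = []")
    case True
    then show ?thesis
      by (intro exI[of _ "[j]"] exI[of _ "[X j]"]) (simp add: generated_subalgebra_base)
  next
    case False
    then obtain ks xs where ks: "ks \<noteq> []" "hd ks = hd js" "last ks = last js" "distinct_adj ks"
      "list_all2 (\<lambda>i x. x \<in> generated_subalgebra smul {X i}) ks xs" "prod_list xs = prod_list (map X js)"
      using Cons.IH by blast
    show ?thesis
    proof (cases "j = hd js")
      case True
      obtain x xs' ks' where x: "xs = x # xs'" "ks = j # ks'"
        using ks True by (metis list.collapse list_all2_Cons1)
      then show ?thesis using ks False
        by (intro exI[of _ "ks"] exI[of _ "(X j * x) # xs'"])
          (auto simp: mult.assoc intro: generated_subalgebra_mult generated_subalgebra_base)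
    next
      case False
      then show ?thesis using ks \<open>js \<noteq> []\<close>
        by (intro exI[of _ "j # ks"] exI[of _ "X j # xs"])
          (auto simp: distinct_adj_Cons generated_subalgebra_base)
    qed
  qed
qed simp

lemma boolean_independent_moment_append:
  assumes ind: "boolean_independent smul \<phi> X"
    and "as \<noteq> []" "bs \<noteq> []" "last as \<noteq> hd bs"
  shows "\<phi> (prod_list (map X (as @ bs))) = \<phi> (prod_list (map X as)) * \<phi> (prod_list (map X bs))"
proof -
  have factor: "\<phi> (prod_list xs) = prod_list (map \<phi> xs)"
    if "distinct_adj ks" "list_all2 (\<lambda>i x. x \<in> generated_subalgebra smul {X i}) ks xs" for ks xs
    using ind that unfolding boolean_independent_def boolean_independent_sets_def by blast
  obtain ks xs where ks: "ks \<noteq> []" "last ks = last as" "distinct_adj ks"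
      "list_all2 (\<lambda>i x. x \<in> generated_subalgebra smul {X i}) ks xs" "prod_list xs = prod_list (map X as)"
    using boolean_word_runs[OF assms(2)] by blast
  obtain js ys where js: "js \<noteq> []" "hd js = hd bs" "distinct_adj js"
      "list_all2 (\<lambda>i x. x \<in> generated_subalgebra smul {X i}) js ys" "prod_list ys = prod_list (map X bs)"
    using boolean_word_runs[OF assms(3)] by blast
  have "distinct_adj (ks @ js)"
    using ks js assms(4) by (simp add: distinct_adj_append_iff)
  moreover have "list_all2 (\<lambda>i x. x \<in> generated_subalgebra smul {X i}) (ks @ js) (xs @ ys)"
    using ks js by (intro list_all2_appendI)
  ultimately have "\<phi> (prod_list (xs @ ys)) = prod_list (map \<phi> xs) * prod_list (map \<phi> ys)"
    using factor by fastforce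
  then show ?thesis
    using factor[OF ks(3,4)] factor[OF js(3,4)] ks(5) js(5) by simp
qed

lemma nonconstant_list_last_run:
  assumes "i \<in> set js" "j \<in> set js" "i \<noteq> j"
  obtains as bs where "js = as @ bs" "as \<noteq> []" "bs \<noteq> []" "last as \<noteq> hd bs" "\<forall>i\<in>set bs. i = hd bs"
proof -
  define P where "P = (\<lambda>i. i = last js)"
  define as bs where "as = rev (dropWhile P (rev js))" and "bs = rev (takeWhile P (rev js))"
  have js: "js = as @ bs"
    unfolding as_def bs_def by (simp flip: rev_append)
  have bs: "\<forall>i\<in>set bs. i = last js"
    unfolding bs_def by (auto dest: set_takeWhileD simp: P_def)
  have "as \<noteq> []"
  proof
    assume "as = []"
    then have "js = bs" using js by simp
    then show False using bs assms by metis
  qed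
  moreover have "js \<noteq> []" using assms by auto
  then have "bs \<noteq> []"
    unfolding bs_def by (cases js rule: rev_cases) (auto simp: P_def)
  moreover have "\<not> P (last as)"
    using \<open>as \<noteq> []\<close> hd_dropWhile[of P "rev js"] by (simp add: as_def last_rev)
  ultimately show ?thesis
    using that[of as bs] js bs by (metis P_def hd_in_set)
qed

text \<open>
  Let the last run of equal letters start after \<open>as\<close>. In the last-block recursion the proper suffixes
  starting earlier are mixed and vanish by induction, and from the remaining suffixes, which lie in
  the last run, the moment of \<open>as\<close> factors out. Their sum is therefore the product of the moments of
  \<open>as\<close> and of the run, which is the moment of the whole word, and nothing is left for the cumulant.
\<close>

lemma mixed_boolean_cumulant_zero:
  assumes ind: "boolean_independent smul \<phi> X" and one: "\<phi> 1 = 1"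
  shows "i \<in> set js \<Longrightarrow> j \<in> set js \<Longrightarrow> i \<noteq> j \<Longrightarrow> boolean_cumulant \<phi> (map X js) = 0"
proof (induction js arbitrary: i j rule: length_induct)
  case (1 js)
  obtain as bs where js: "js = as @ bs" "as \<noteq> []" "bs \<noteq> []" "last as \<noteq> hd bs"
    and bs: "\<forall>i\<in>set bs. i = hd bs"
    using nonconstant_list_last_run[OF 1(2-4)] .
  let ?M = "\<lambda>ks. \<phi> (prod_list (map X ks))" and ?K = "\<lambda>ks. boolean_cumulant \<phi> (map X ks)"
  let ?p = "length as" and ?n = "length js"
  have rec: "?M ks = (\<Sum>k<length ks. ?M (take k ks) * ?K (drop k ks))" if "ks \<noteq> []" for ks
    using moment_last_block[of \<phi> "map X ks", OF one] that by (simp add: take_map drop_map)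
  have "?M js = (\<Sum>k<?n. ?M (take k js) * ?K (drop k js))"
    using rec js(1,2) by blast
  also have "\<dots> = (\<Sum>k=0..<?p. ?M (take k js) * ?K (drop k js)) +
      (\<Sum>k=?p..<?p + length bs. ?M (take k js) * ?K (drop k js))"
    using js(1) by (simp only: lessThan_atLeast0 sum.atLeastLessThan_concat length_append le0 le_add1)
  also have "(\<Sum>k=0..<?p. ?M (take k js) * ?K (drop k js)) =
      ?K js + (\<Sum>k=1..<?p. ?M (take k js) * ?K (drop k js))"
    using js by (simp add: sum.atLeast_Suc_lessThan one)
  also have "(\<Sum>k=1..<?p. ?M (take k js) * ?K (drop k js)) = 0"
  proof (rule sum.neutral, safe)
    fix k assume k: "k \<in> {1..<?p}"
    then have "last as \<in> set (drop k as)" by (metis atLeastLessThan_iff drop_eq_Nil last_drop last_in_set not_le)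
    \<comment> \<open>A suffix starting inside \<open>as\<close> meets both sides of the boundary between \<open>as\<close> and \<open>bs\<close>.\<close>
    then have "last as \<in> set (drop k js)" "hd bs \<in> set (drop k js)"
      using js k by auto
    moreover have "length (drop k js) < ?n" using k js by auto
    ultimately have "?K (drop k js) = 0"
      using 1(1) js(4) by blast
    then show "?M (take k js) * ?K (drop k js) = 0" by simp
  qed
  also have "(\<Sum>k=?p..<?p + length bs. ?M (take k js) * ?K (drop k js)) =
      (\<Sum>l<length bs. ?M (take (?p + l) js) * ?K (drop (?p + l) js))"
    using sum.shift_bounds_nat_ivl[of _ 0 ?p "length bs"]
    by (simp add: lessThan_atLeast0 add.commute)
  also have "\<dots> = (\<Sum>l<length bs. ?M as * (?M (take l bs) * ?K (drop l bs)))"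
  proof (rule sum.cong[OF refl])
    fix l assume "l \<in> {..<length bs}"
    have "?M (as @ take l bs) = ?M as * ?M (take l bs)"
    proof (cases "l = 0")
      case False
      then show ?thesis
        using js by (intro boolean_independent_moment_append[OF ind]) auto
    qed (simp add: one)
    then show "?M (take (?p + l) js) * ?K (drop (?p + l) js) = ?M as * (?M (take l bs) * ?K (drop l bs))"
      using js by simp
  qed
  also have "\<dots> = ?M as * ?M bs"
    unfolding rec[OF js(3)] by (simp add: sum_distrib_left)
  finally have "?M js = ?K js + ?M as * ?M bs" by simp
  moreover have "?M js = ?M as * ?M bs"
    unfolding js(1) by (rule boolean_independent_moment_append[OF ind js(2-4)])
  ultimately show ?case by simp
qed

lemma nths_eq_replicate:
  assumes "\<And>k. k < length js \<Longrightarrow> Suc k \<in> B \<Longrightarrow> js ! k = i" and "B \<subseteq> {1..length js}"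
  shows "nths js {k. Suc k \<in> B} = replicate (card B) i"
proof -
  have "bij_betw Suc {k. k < length js \<and> Suc k \<in> B} B"
    by (rule bij_betw_byWitness[where f' = "\<lambda>k. k - 1"]) (use assms(2) in force)+
  then have "length (nths js {k. Suc k \<in> B}) = card B"
    unfolding length_nths mem_Collect_eq by (rule bij_betw_same_card)
  then show ?thesis
    using assms(1) by (intro replicate_eqI) (auto simp: set_nths)
qed

lemma cumulant_partition_mixed_zero:
  assumes ind: "boolean_independent smul \<phi> X" and one: "\<phi> 1 = 1"
    and \<pi>: "\<pi> \<in> interval_partitions (length js)"
    and not_constant: "\<not> (\<forall>B\<in>\<pi>. \<forall>k\<in>B. \<forall>l\<in>B. js ! (k - 1) = js ! (l - 1))"
  shows "cumulant_partition \<phi> \<pi> (map X js) = 0"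
proof -
  note part = interval_partitionsD(1)[OF \<pi>]
  obtain B k l where B: "B \<in> \<pi>" "k \<in> B" "l \<in> B" "js ! (k - 1) \<noteq> js ! (l - 1)"
    using not_constant by blast
  have "B \<subseteq> {1..length js}" using partition_onD1[OF part] B(1) by blast
  then have "js ! (k - 1) \<in> set (nths js {j. Suc j \<in> B})" "js ! (l - 1) \<in> set (nths js {j. Suc j \<in> B})"
    using B(2,3) unfolding set_nths by (auto 4 4 dest: subsetD[of B _ k] subsetD[of B _ l])
  then have "boolean_cumulant \<phi> (map X (nths js {j. Suc j \<in> B})) = 0"
    using B(4) by (rule mixed_boolean_cumulant_zero[OF ind one])
  moreover have "finite \<pi>" by (rule finite_elements[OF _ part]) simp
  ultimately show ?thesis
    using B(1) unfolding cumulant_partition_def nths_map by (metis (mono_tags, lifting) prod_zero)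
qed

lemma cumulant_partition_identically_distributed:
  assumes x: "\<And>i. identically_distributed \<phi> x (X i)"
    and \<pi>: "\<pi> \<in> interval_partitions (length js)"
    and const: "\<forall>B\<in>\<pi>. \<forall>k\<in>B. \<forall>l\<in>B. js ! (k - 1) = js ! (l - 1)"
  shows "cumulant_partition \<phi> \<pi> (map X js) = cumulant1_partition \<phi> \<pi> x"
  unfolding cumulant_partition_def cumulant1_partition_def
proof (rule prod.cong[OF refl])
  fix B assume B: "B \<in> \<pi>"
  note part = interval_partitionsD(1)[OF \<pi>]
  have sub: "B \<subseteq> {1..length js}" using partition_onD1[OF part] B(1) by blast
  have "B \<noteq> {}" using partition_onD3[OF part] B by blast
  then obtain l where l: "l \<in> B" by blast
  have "nths js {k. Suc k \<in> B} = replicate (card B) (js ! (l - 1))"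
  proof (rule nths_eq_replicate[OF _ sub])
    fix k assume "Suc k \<in> B"
    then have "js ! (Suc k - 1) = js ! (l - 1)" using const B l by blast
    then show "js ! k = js ! (l - 1)" by simp
  qed
  moreover have "card B \<ge> 1"
    using \<open>B \<noteq> {}\<close> finite_subset[OF sub] by (simp add: Suc_le_eq card_gt_0_iff)
  ultimately show "boolean_cumulant \<phi> (nths (map X js) {k. Suc k \<in> B}) = cumulant1 \<phi> (card B) x"
    using x[of "js ! (l - 1)"] by (simp add: nths_map identically_distributed_def cumulant1_def)
qed

section \<open>Paths and the hat bijection\<close>

text \<open>
  The replacement sets are the fibres of a single map, which turns the hat of a partition into its
  preimage.
\<close>

lemma hat_set_eq:
  assumes "r \<ge> 1" "t \<in> {1..r+1}"
  shows "hat_set r t = {s \<in> {1..2 * r}. s div 2 + 1 = t}"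
proof -
  have "s \<in> hat_set r t \<longleftrightarrow> s \<in> {1..2 * r} \<and> s div 2 + 1 = t" for s
    using assms by (auto simp: hat_set_def)
  then show ?thesis by blast
qed

lemma hat_partition_eq:
  assumes "r \<ge> 1" "\<pi> \<in> interval_partitions (r + 1)"
  shows "hat_partition r \<pi> = (\<lambda>B. {s \<in> {1..2 * r}. s div 2 + 1 \<in> B}) ` \<pi>"
  unfolding hat_partition_def
proof (rule image_cong[OF refl])
  fix B assume "B \<in> \<pi>"
  then have "B \<subseteq> {1..r+1}"
    using partition_onD1[OF interval_partitionsD(1)[OF assms(2)]] by blast
  then have "(\<Union>t\<in>B. hat_set r t) = (\<Union>t\<in>B. {s \<in> {1..2 * r}. s div 2 + 1 = t})"
    using hat_set_eq[OF assms(1)] by blast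
  then show "(\<Union>t\<in>B. hat_set r t) = {s \<in> {1..2 * r}. s div 2 + 1 \<in> B}" by blast
qed

lemma hat_partition_interval:
  assumes "r \<ge> 1" "\<pi> \<in> interval_partitions (r + 1)"
  shows "hat_partition r \<pi> \<in> interval_partitions (2 * r)"
proof -
  note part = interval_partitionsD(1)[OF assms(2)]
  let ?pre = "\<lambda>B. {s \<in> {1..2 * r}. s div 2 + 1 \<in> B}"
  have mem: "s div 2 + 1 \<in> {1..r+1}" if "s \<in> {1..2 * r}" for s
    using that by auto
  have union: "\<Union>(?pre ` \<pi>) = {1..2 * r}"
  proof (rule Set.set_eqI)
    fix s
    show "s \<in> \<Union>(?pre ` \<pi>) \<longleftrightarrow> s \<in> {1..2 * r}"
      using mem[of s] unfolding partition_onD1[OF part] by auto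
  qed
  have disjnt: "disjnt (?pre B) (?pre C)" if "B \<in> \<pi>" "C \<in> \<pi>" "?pre B \<noteq> ?pre C" for B C
  proof -
    have "x \<notin> C" if "x \<in> B" for x
      using partition_on_block_unique[OF part \<open>B \<in> \<pi>\<close> \<open>C \<in> \<pi>\<close> that] \<open>?pre B \<noteq> ?pre C\<close> by metis
    then show ?thesis unfolding disjnt_iff by simp
  qed
  have nonempty: "?pre B \<noteq> {}" if "B \<in> \<pi>" for B
  proof -
    have "B \<noteq> {}" "B \<subseteq> {1..r+1}" using partition_onD3[OF part] partition_onD1[OF part] that by blast+
    then obtain t where t: "t \<in> B" "t \<in> {1..r+1}" by blast
    \<comment> \<open>The least element of the set replacing \<open>t\<close>; the maximum takes care of \<open>t = 1\<close>.\<close>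
    have "max 1 (2 * t - 2) \<in> {1..2 * r}" "max 1 (2 * t - 2) div 2 + 1 = t"
      using t(2) assms(1) by (auto simp: max_def)
    then have "max 1 (2 * t - 2) \<in> ?pre B" using t(1) by simp
    then show ?thesis by blast
  qed
  have "partition_on {1..2 * r} (?pre ` \<pi>)"
  proof (rule partition_onI[OF union])
    show "disjnt p q" if "p \<in> ?pre ` \<pi>" "q \<in> ?pre ` \<pi>" "p \<noteq> q" for p q
      using that disjnt by (elim imageE) simp
    show "{} \<notin> ?pre ` \<pi>"
    proof
      assume "{} \<in> ?pre ` \<pi>"
      then obtain B where "{} = ?pre B" "B \<in> \<pi>" by (rule imageE)
      then show False using nonempty[of B] by simp
    qed
  qed
  moreover have "\<exists>a b. ?pre B = {a..b}" if B: "B \<in> \<pi>" for B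
  proof -
    obtain a b where "B = {a..b}" using interval_partitionsD(2)[OF assms(2) B] by blast
    then have "s \<in> ?pre B \<longleftrightarrow> s \<in> {max 1 (2 * a - 2)..min (2 * r) (2 * b - 1)}" for s
      by auto
    then have "?pre B = {max 1 (2 * a - 2)..min (2 * r) (2 * b - 1)}" by blast
    then show ?thesis by blast
  qed
  ultimately show ?thesis
    unfolding hat_partition_eq[OF assms] interval_partitions_def by blast
qed

text \<open>
  An even point and its successor have the same image under the fibre map, so they are never
  separated; the points \<open>2c - 1\<close> and \<open>2c\<close> are mapped to \<open>c\<close> and \<open>c + 1\<close>.
\<close>

lemma cut_points_hat_partition:
  assumes "r \<ge> 1" "\<pi> \<in> interval_partitions (r + 1)"
  shows "cut_points (2 * r) (hat_partition r \<pi>) = (\<lambda>c. 2 * c - 1) ` cut_points (r + 1) \<pi>"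
proof -
  note part = interval_partitionsD(1)[OF assms(2)]
  have "c \<in> cut_points (2 * r) (hat_partition r \<pi>) \<longleftrightarrow> c \<in> (\<lambda>c. 2 * c - 1) ` cut_points (r + 1) \<pi>" for c
  proof (cases "c \<in> {1..<2 * r}")
    case True
    then have c: "c \<in> {1..2 * r}" "Suc c \<in> {1..2 * r}" by auto
    have *: "c \<in> cut_points (2 * r) (hat_partition r \<pi>) \<longleftrightarrow>
        (\<forall>B\<in>\<pi>. \<not> (c div 2 + 1 \<in> B \<and> Suc c div 2 + 1 \<in> B))"
      using c True unfolding hat_partition_eq[OF assms] cut_points_def by simp
    show ?thesis
    proof (cases "even c")
      case even: True
      then have "Suc c div 2 = c div 2" by simp
      moreover have "c div 2 + 1 \<in> {1..r+1}" using c by auto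
      then obtain B where "B \<in> \<pi>" "c div 2 + 1 \<in> B"
        using partition_on_obtain_block[OF part] by blast
      ultimately have "c \<notin> cut_points (2 * r) (hat_partition r \<pi>)" unfolding * by auto
      moreover have "c \<notin> (\<lambda>c. 2 * c - 1) ` cut_points (r + 1) \<pi>"
        using even cut_points_subset[of "r + 1" \<pi>] by (auto dest!: subsetD)
      ultimately show ?thesis by blast
    next
      case False
      then obtain d where "c = 2 * d + 1" by (rule oddE)
      then have d: "c = 2 * Suc d - 1" "Suc d \<in> {1..<r+1}" "c div 2 = d" "Suc c div 2 = Suc d"
        using c by auto
      have "x = Suc d" if "x \<in> cut_points (r + 1) \<pi>" "c = 2 * x - 1" for x
        using that d(1) subsetD[OF cut_points_subset that(1)] by simp
      then have "c \<in> (\<lambda>c. 2 * c - 1) ` cut_points (r + 1) \<pi> \<longleftrightarrow> Suc d \<in> cut_points (r + 1) \<pi>"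
        using d(1) by blast
      then show ?thesis using d(2) unfolding * d(3,4) by (auto simp: cut_points_def)
    qed
  next
    case False
    moreover have "2 * d - 1 \<in> {1..<2 * r}" if "d \<in> {1..<r+1}" for d
      using that by auto
    ultimately show ?thesis
      using cut_points_subset[of "2 * r" "hat_partition r \<pi>"] cut_points_subset[of "r + 1" \<pi>] by blast
  qed
  then show ?thesis by blast
qed

lemma bij_betw_hat_partition:
  assumes "r \<ge> 1"
  shows "bij_betw (hat_partition r) (interval_partitions (r + 1))
    {\<sigma> \<in> interval_partitions (2 * r). cut_points (2 * r) \<sigma> \<subseteq> {c. odd c}}"
proof (rule bij_betw_imageI)
  let ?h = "\<lambda>c::nat. 2 * c - 1"
  have inj: "inj_on ?h {1..<r+1}" by (auto simp: inj_on_def)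
  show "inj_on (hat_partition r) (interval_partitions (r + 1))"
  proof (rule inj_onI)
    fix \<pi> \<sigma> assume *: "\<pi> \<in> interval_partitions (r + 1)" "\<sigma> \<in> interval_partitions (r + 1)"
      "hat_partition r \<pi> = hat_partition r \<sigma>"
    then have "?h ` cut_points (r + 1) \<pi> = ?h ` cut_points (r + 1) \<sigma>"
      using cut_points_hat_partition[OF assms] by metis
    then have "cut_points (r + 1) \<pi> = cut_points (r + 1) \<sigma>"
      using inj_on_image_eq_iff[OF inj cut_points_subset cut_points_subset] by simp
    then show "\<pi> = \<sigma>" by (rule interval_partition_eqI[OF *(1,2)])
  qed
  show "hat_partition r ` interval_partitions (r + 1) =
    {\<sigma> \<in> interval_partitions (2 * r). cut_points (2 * r) \<sigma> \<subseteq> {c. odd c}}"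
  proof (intro equalityI subsetI)
    fix \<sigma> assume "\<sigma> \<in> hat_partition r ` interval_partitions (r + 1)"
    then obtain \<pi> where \<pi>: "\<pi> \<in> interval_partitions (r + 1)" "\<sigma> = hat_partition r \<pi>" by blast
    have "odd (?h c)" if "c \<in> cut_points (r + 1) \<pi>" for c
      using subsetD[OF cut_points_subset that] by auto
    then have "cut_points (2 * r) \<sigma> \<subseteq> {c. odd c}"
      unfolding \<pi>(2) cut_points_hat_partition[OF assms \<pi>(1)] by blast
    then show "\<sigma> \<in> {\<sigma> \<in> interval_partitions (2 * r). cut_points (2 * r) \<sigma> \<subseteq> {c. odd c}}"
      using hat_partition_interval[OF assms \<pi>(1)] \<pi>(2) by simp
  next
    fix \<sigma> assume "\<sigma> \<in> {\<sigma> \<in> interval_partitions (2 * r). cut_points (2 * r) \<sigma> \<subseteq> {c. odd c}}"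
    then have \<sigma>: "\<sigma> \<in> interval_partitions (2 * r)" and odd: "\<And>c. c \<in> cut_points (2 * r) \<sigma> \<Longrightarrow> odd c"
      by blast+
    \<comment> \<open>The cuts of the preimage, read off from the odd cuts of \<open>\<sigma>\<close>.\<close>
    define S where "S = {c \<in> {1..<r+1}. ?h c \<in> cut_points (2 * r) \<sigma>}"
    let ?\<pi> = "cut_partition (r + 1) S"
    have "c \<in> ?h ` S" if c: "c \<in> cut_points (2 * r) \<sigma>" for c
    proof -
      obtain d where "c = 2 * d + 1" using odd[OF c] by (rule oddE)
      moreover have "c \<in> {1..<2 * r}" using subsetD[OF cut_points_subset c] .
      ultimately have "Suc d \<in> S" "c = ?h (Suc d)" using c by (auto simp: S_def)
      then show ?thesis by blast
    qed
    then have "?h ` S = cut_points (2 * r) \<sigma>" by (auto simp: S_def)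
    moreover have "cut_points (r + 1) ?\<pi> = S"
      by (rule cut_points_cut_partition) (auto simp: S_def)
    ultimately have "cut_points (2 * r) (hat_partition r ?\<pi>) = cut_points (2 * r) \<sigma>"
      unfolding cut_points_hat_partition[OF assms cut_partition_interval] by simp
    then have "hat_partition r ?\<pi> = \<sigma>"
      by (rule interval_partition_eqI[OF hat_partition_interval[OF assms cut_partition_interval] \<sigma>])
    then show "\<sigma> \<in> hat_partition r ` interval_partitions (r + 1)"
      using cut_partition_interval by blast
  qed
qed

lemma refines_ker_partition_iff:
  assumes "\<pi> \<in> interval_partitions (r + 1)"
  shows "refines {1..r+1} \<pi> (ker_partition r i) \<longleftrightarrow>
    (\<forall>B\<in>\<pi>. \<forall>k\<in>B. \<forall>l\<in>B. i (k - 1) = i (l - 1))"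
proof -
  note part = interval_partitionsD(1)[OF assms]
  have ker: "partition_on {1..r+1} (ker_partition r i)"
    unfolding ker_partition_def by (rule partition_on_quotient[OF equiv_kernel_on])
  have sub: "B \<subseteq> {1..r+1}" "B \<noteq> {}" if "B \<in> \<pi>" for B
    using partition_onD1[OF part] partition_onD3[OF part] that by blast+
  show ?thesis
  proof
    assume "refines {1..r+1} \<pi> (ker_partition r i)"
    then have coarser: "\<exists>C\<in>ker_partition r i. B \<subseteq> C" if "B \<in> \<pi>" for B
      using that unfolding refines_def by blast
    have "\<exists>c. \<forall>k\<in>B. i (c - 1) = i (k - 1)" if B: "B \<in> \<pi>" for B
    proof -
      obtain C where C: "C \<in> ker_partition r i" "B \<subseteq> C" using coarser[OF B] by blast
      then obtain c where "C = {l \<in> {1..r+1}. i (c - 1) = i (l - 1)}"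
        unfolding ker_partition_def quotient_kernel_on by (elim imageE)
      with C(2) show ?thesis by blast
    qed
    then show "\<forall>B\<in>\<pi>. \<forall>k\<in>B. \<forall>l\<in>B. i (k - 1) = i (l - 1)" by metis
  next
    assume *: "\<forall>B\<in>\<pi>. \<forall>k\<in>B. \<forall>l\<in>B. i (k - 1) = i (l - 1)"
    have "\<exists>C\<in>ker_partition r i. B \<subseteq> C" if B: "B \<in> \<pi>" for B
    proof -
      obtain k where "k \<in> B" using sub(2)[OF B] by blast
      then have "B \<subseteq> {l \<in> {1..r+1}. i (k - 1) = i (l - 1)}" "k \<in> {1..r+1}"
        using * sub(1)[OF B] B by blast+
      then show ?thesis unfolding ker_partition_def quotient_kernel_on by blast
    qed
    then show "refines {1..r+1} \<pi> (ker_partition r i)"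
      using part ker unfolding refines_def by blast
  qed
qed

definition path_steps :: "nat \<Rightarrow> (nat \<Rightarrow> 'i) \<Rightarrow> ('i \<times> 'i) list" where
  "path_steps r i = map (\<lambda>k. (i k, i (Suc k))) [0..<r]"

text \<open>
  The word \<open>i\<^sub>0 i\<^sub>1 i\<^sub>1 \<dots> i\<^sub>r\<^sub>-\<^sub>1 i\<^sub>r\<^sub>-\<^sub>1 i\<^sub>r\<close>.
\<close>

definition path_word :: "nat \<Rightarrow> (nat \<Rightarrow> 'i) \<Rightarrow> 'i list" where
  "path_word r i = map (\<lambda>s. i (Suc s div 2)) [0..<2 * r]"

lemma flatten_pairs_append: "flatten_pairs (ps @ qs) = flatten_pairs ps @ flatten_pairs qs"
  by (simp add: flatten_pairs_def)

lemma flatten_path_steps: "flatten_pairs (path_steps r i) = path_word r i"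
proof (induction r)
  case 0
  show ?case by (simp add: path_steps_def path_word_def)
next
  case (Suc r)
  have "path_steps (Suc r) i = path_steps r i @ [(i r, i (Suc r))]"
    "path_word (Suc r) i = path_word r i @ [i r, i (Suc r)]"
    by (simp_all add: path_steps_def path_word_def)
  then show ?case using Suc by (simp add: flatten_pairs_append)
qed

lemma map_path_word:
  assumes "r \<ge> 1"
  shows "map X (path_word r i) = X (i 0) # concat (map (\<lambda>k. [X (i k), X (i k)]) [1..<r]) @ [X (i r)]"
  using assms
proof (induction r rule: dec_induct)
  case base
  show ?case by (simp add: path_word_def upt_rec)
next
  case (step r)
  have "path_word (Suc r) i = path_word r i @ [i r, i (Suc r)]"
    by (simp add: path_word_def)
  then show ?case using step by simp
qed

lemma flatten_pairs_nth:
  assumes "k < length ps"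
  shows "flatten_pairs ps ! (2 * k) = fst (ps ! k)" "flatten_pairs ps ! Suc (2 * k) = snd (ps ! k)"
  using assms
proof (induction ps arbitrary: k)
  case (Cons p ps)
  obtain x y where p: "p = (x, y)" by (cases p)
  { case 1 then show ?case using Cons.IH(1)[of "k - 1"] by (cases k) (auto simp: p) }
  { case 2 then show ?case using Cons.IH(2)[of "k - 1"] by (cases k) (auto simp: p) }
qed simp_all

lemma map_flatten_pairs: "map X (flatten_pairs es) = flatten_pairs (map (\<lambda>(i, j). (X i, X j)) es)"
  by (induction es) auto

text \<open>
  The letters at positions \<open>2k\<close> and \<open>2k + 1\<close> lie in a common block when the even number \<open>2k\<close> is not
  a cut, so a mismatch between them makes every cumulant of the sum mixed.
\<close>

lemma restricted_moment_not_path_zero: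
  assumes ind: "boolean_independent smul \<phi> X" and one: "\<phi> 1 = 1"
    and k: "Suc k < length es" "snd (es ! k) \<noteq> fst (es ! Suc k)"
  shows "restricted_moment \<phi> {c. odd c} (map X (flatten_pairs es)) = 0"
  unfolding restricted_moment_def
proof (rule sum.neutral, safe)
  let ?js = "flatten_pairs es"
  fix \<pi> assume "\<pi> \<in> interval_partitions (length (map X ?js))"
    and odd: "cut_points (length (map X ?js)) \<pi> \<subseteq> {c. odd c}"
  then have \<pi>: "\<pi> \<in> interval_partitions (length ?js)" by simp
  show "cumulant_partition \<phi> \<pi> (map X ?js) = 0"
  proof (rule cumulant_partition_mixed_zero[OF ind one \<pi>])
    let ?c = "2 * Suc k"
    have "?c \<in> {1..<length ?js} - cut_points (length ?js) \<pi>" using odd k(1) by auto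
    moreover have "?js ! (?c - 1) \<noteq> ?js ! (Suc ?c - 1)"
      using k flatten_pairs_nth(2)[of k es] flatten_pairs_nth(1)[of "Suc k" es] by simp
    ultimately show "\<not> (\<forall>B\<in>\<pi>. \<forall>k\<in>B. \<forall>l\<in>B. ?js ! (k - 1) = ?js ! (l - 1))"
      unfolding constant_on_blocks_iff[OF \<pi>, of "\<lambda>k. ?js ! (k - 1)"] by blast
  qed
qed

lemma sum_path_steps:
  fixes f :: "('n::finite \<times> 'n) list \<Rightarrow> 'b::comm_monoid_add"
  assumes r: "r \<ge> 1"
    and zero: "\<And>es k. length es = r \<Longrightarrow> Suc k < r \<Longrightarrow> snd (es ! k) \<noteq> fst (es ! Suc k) \<Longrightarrow> f es = 0"
  shows "(\<Sum>es | length es = r. f es) = (\<Sum>i\<in>{0..r} \<rightarrow>\<^sub>E UNIV. f (path_steps r i))"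
proof -
  let ?I = "{0..r} \<rightarrow>\<^sub>E (UNIV :: 'n set)"
  have inj: "inj_on (path_steps r) ?I"
  proof (rule inj_onI)
    fix i j :: "nat \<Rightarrow> 'n" assume *: "i \<in> ?I" "j \<in> ?I" "path_steps r i = path_steps r j"
    have "i k = j k \<and> i (Suc k) = j (Suc k)" if "k < r" for k
      using arg_cong[OF *(3), of "\<lambda>es. es ! k"] that by (simp add: path_steps_def)
    then have "i k = j k" if "k \<in> {0..r}" for k
      using that r by (cases k) auto
    then show "i = j" by (rule PiE_ext[OF *(1,2)])
  qed
  have "es \<in> path_steps r ` ?I"
    if es: "length es = r" "\<And>k. Suc k < r \<Longrightarrow> snd (es ! k) = fst (es ! Suc k)" for es
  proof -
    \<comment> \<open>The values outside \<open>{0..r}\<close> are the default value that extensional functions take there.\<close>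
    define i where "i k = (if k = 0 then fst (es ! 0) else if k \<le> r then snd (es ! (k - 1)) else undefined)" for k
    have "i \<in> ?I" by (auto simp: i_def PiE_iff extensional_def)
    moreover have "es = path_steps r i"
    proof (rule nth_equalityI)
      fix k assume "k < length es"
      then show "es ! k = path_steps r i ! k"
        using es by (cases k) (auto simp: path_steps_def i_def intro!: prod_eqI)
    qed (simp add: es path_steps_def)
    ultimately show ?thesis by blast
  qed
  then have "f es = 0" if "length es = r" "es \<notin> path_steps r ` ?I" for es
    using that zero by metis
  then have "(\<Sum>es | length es = r. f es) = (\<Sum>es\<in>path_steps r ` ?I. f es)"
    by (intro sum.mono_neutral_right) (auto simp: path_steps_def)
  then show ?thesis by (simp add: sum.reindex[OF inj])
qed

lemma matrix_prod_simps [simp]: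
  "matrix_prod [] = mat 1" "matrix_prod (M # Ms) = M ** matrix_prod Ms"
  by (simp_all add: matrix_prod_def)

lemma matrix_prod_append: "matrix_prod (Ms @ Ns) = matrix_prod Ms ** matrix_prod Ns"
  by (induction Ms) (simp_all add: matrix_mul_assoc)

text \<open>
  The product of projections and copies of \<open>A\<close> has a single nonzero entry, in row \<open>i\<^sub>0\<close> and
  column \<open>i\<^sub>r\<close>. The matrix of ones then closes up the trace with the factor 1.
\<close>

lemma path_weight_eq:
  "path_weight A r i = prod_list (map (\<lambda>(j, k). A $ j $ k) (path_steps r i))"
proof -
  define w where "w r = prod_list (map (\<lambda>(j, k). A $ j $ k) (path_steps r i))" for r
  define L where "L r = unit_projection (i 0) # concat (map (\<lambda>k. [A, unit_projection (i k)]) [1..<r + 1])" for r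
  have delta: "(\<Sum>k\<in>UNIV. (if P \<and> k = q then c else 0) * f k) = (if P then c * f q else 0)"
    for P and q :: 'a and c :: complex and f
    by (cases P) (simp_all add: if_distrib[of "\<lambda>x. x * _"] sum.delta cong: if_cong)
  have "matrix_prod (L r) = (\<chi> a b. if a = i 0 \<and> b = i r then w r else 0)"
  proof (induction r)
    case 0
    show ?case by (simp add: L_def w_def path_steps_def unit_projection_def cong: if_cong)
  next
    case (Suc r)
    let ?U = "\<chi> a b. if a = i 0 \<and> b = i r then w r else 0"
    have L: "L (Suc r) = L r @ [A, unit_projection (i (Suc r))]"
      by (simp add: L_def)
    have w: "w (Suc r) = w r * A $ i r $ i (Suc r)"
      by (simp add: w_def path_steps_def)
    have AE: "(A ** unit_projection k) $ a $ b = (if b = k then A $ a $ k else 0)" for a b k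
      by (cases "b = k") (simp_all add: matrix_matrix_mult_def unit_projection_def
          if_distrib[of "\<lambda>x. _ * x"] sum.delta cong: if_cong)
    have U: "matrix_prod (L (Suc r)) = ?U ** (A ** unit_projection (i (Suc r)))"
      using Suc by (simp add: L matrix_prod_append)
    have "matrix_prod (L (Suc r)) $ a $ b = (if a = i 0 \<and> b = i (Suc r) then w (Suc r) else 0)" for a b
      unfolding U by (simp add: matrix_matrix_mult_def[of ?U] delta AE w)
    then show ?case by (simp add: vec_eq_iff)
  qed
  moreover have "trace (ones_matrix ** (\<chi> a b. if a = p \<and> b = q then c else 0)) = c"
    for p q :: 'a and c :: complex
  proof -
    have "(\<Sum>k\<in>UNIV. if k = p \<and> b = q then c else 0) = (if b = q then c else 0)" for b
      by (cases "b = q") (simp_all add: sum.delta)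
    then show ?thesis
      by (simp add: trace_def ones_matrix_def matrix_matrix_mult_def sum.delta)
  qed
  ultimately show ?thesis
    unfolding path_weight_def L_def w_def by simp
qed

section \<open>Interval complement and closure\<close>

definition block_starts :: "nat \<Rightarrow> nat set set \<Rightarrow> nat set" where
  "block_starts m \<pi> = insert 1 (Suc ` cut_points m \<pi>)"

lemma block_starts_subset: "m \<ge> 1 \<Longrightarrow> block_starts m \<pi> \<subseteq> {1..m}"
  using cut_points_subset[of m \<pi>] unfolding block_starts_def by force

lemma not_block_start:
  assumes "t \<in> {1..m}" "t \<notin> block_starts m \<pi>"
  obtains B where "B \<in> \<pi>" "t - 1 \<in> B" "t \<in> B" "t > 1"
proof -
  have "t \<noteq> 1" using assms(2) by (auto simp: block_starts_def)
  then obtain c where c: "t = Suc c" "c \<in> {1..<m}"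
    using assms(1) by (cases t) auto
  then have "c \<notin> cut_points m \<pi>" using assms(2) by (auto simp: block_starts_def)
  with c that show ?thesis unfolding cut_points_def by force
qed

text \<open>
  A block is an interval, so it contains with \<open>k\<close> and \<open>l\<close> everything between them, and only its least
  element is a block start.
\<close>

lemma interval_block_between:
  assumes \<pi>: "\<pi> \<in> interval_partitions m" and B: "B \<in> \<pi>" "k \<in> B" "l \<in> B"
    and "k < j" "j \<le> l"
  shows "j \<in> B" "j \<notin> block_starts m \<pi>"
proof -
  obtain a b where ab: "B = {a..b}" using interval_partitionsD(2)[OF \<pi> B(1)] by blast
  then show "j \<in> B" using assms by auto
  have "j - 1 \<in> B" "Suc (j - 1) \<in> B" using ab assms by auto
  then have "j - 1 \<notin> cut_points m \<pi>" using B(1) unfolding cut_points_def by blast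
  moreover have "k \<ge> 1"
    using partition_onD1[OF interval_partitionsD(1)[OF \<pi>]] B(1,2) by fastforce
  ultimately show "j \<notin> block_starts m \<pi>"
    using \<open>k < j\<close> by (auto simp: block_starts_def)
qed

lemma greatest_refinement_eqI:
  assumes "\<sigma> \<in> S" "S \<subseteq> P" "\<And>\<tau>. \<tau> \<in> S \<Longrightarrow> refines {1..m} \<tau> \<sigma>"
  shows "(THE \<sigma>. greatest (refinement_order m P) \<sigma> S) = \<sigma>"
proof (rule the_equality)
  show "greatest (refinement_order m P) \<sigma> S"
    using assms by (simp add: greatest_def refinement_order_def)
  show "\<tau> = \<sigma>" if "greatest (refinement_order m P) \<tau> S" for \<tau>
    using that assms by (intro refines_asym[of "{1..m}"]) (simp_all add: greatest_def refinement_order_def)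
qed

lemma noncrossingI:
  assumes "\<And>B C a b c d. B \<in> \<pi> \<Longrightarrow> C \<in> \<pi> \<Longrightarrow> B \<noteq> C \<Longrightarrow> a \<in> B \<Longrightarrow> b \<in> C \<Longrightarrow> c \<in> B \<Longrightarrow> d \<in> C \<Longrightarrow>
    a < b \<Longrightarrow> b < c \<Longrightarrow> c < d \<Longrightarrow> False"
  shows "noncrossing \<pi>"
  unfolding noncrossing_def using assms by blast

lemma noncrossingD:
  assumes "noncrossing \<pi>" "B \<in> \<pi>" "C \<in> \<pi>" "a \<in> B" "b \<in> C" "c \<in> B" "d \<in> C" "a < b" "b < c" "c < d"
  shows "B = C"
  using assms unfolding noncrossing_def by blast

text \<open>
  The value of the interval complement of \<open>\<pi>\<close>.
\<close>

definition starts_partition :: "nat \<Rightarrow> nat set set \<Rightarrow> nat set set" where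
  "starts_partition m \<pi> = insert (block_starts m \<pi>) ((\<lambda>k. {k}) ` ({1..m} - block_starts m \<pi>))"

lemma partition_on_insert_complement:
  assumes "J \<subseteq> A" "J \<noteq> {}" "partition_on (A - J) P"
  shows "partition_on A (insert J P)"
  using assms partition_onD1[OF assms(3)] by (subst partition_on_insert) (auto simp: disjnt_iff)

lemma starts_partition_noncrossing:
  assumes "m \<ge> 1"
  shows "starts_partition m \<pi> \<in> noncrossing_partitions m"
proof -
  have "partition_on {1..m} (starts_partition m \<pi>)"
    unfolding starts_partition_def using block_starts_subset[OF assms]
    by (intro partition_on_insert_complement partition_on_singletons) (auto simp: block_starts_def)
  moreover have "noncrossing (starts_partition m \<pi>)"
    by (rule noncrossingI) (auto simp: starts_partition_def)
  ultimately show ?thesis by (simp add: noncrossing_partitions_def)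
qed

lemma first_block_insert_starts:
  assumes "partition_on {1..m} (insert (block_starts m \<pi>) P)"
  shows "first_block (insert (block_starts m \<pi>) P) = block_starts m \<pi>"
  unfolding first_block_def
proof (rule the_equality)
  show "block_starts m \<pi> \<in> insert (block_starts m \<pi>) P \<and> 1 \<in> block_starts m \<pi>"
    by (simp add: block_starts_def)
  show "B = block_starts m \<pi>" if "B \<in> insert (block_starts m \<pi>) P \<and> 1 \<in> B" for B
    using partition_on_block_unique[OF assms, of B "block_starts m \<pi>" 1] that
    by (simp add: block_starts_def)
qed

lemma interleave_cases:
  assumes "B \<in> interleave \<sigma> \<pi>"
  obtains (bar) D where "D \<in> \<sigma>" "B = (\<lambda>k. 2 * k - 1) ` D" | (plain) D where "D \<in> \<pi>" "B = (\<lambda>k. 2 * k) ` D"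
  using assms unfolding interleave_def by blast

text \<open>
  Only the block of starts has more than one barred point. A block of \<open>\<pi>\<close> crossing it would
  surround a barred start \<open>j\<close>, hence contain both \<open>j - 1\<close> and \<open>j\<close>, which a start forbids. Two blocks of
  \<open>\<pi>\<close> cannot cross because they are intervals.
\<close>

lemma interleave_starts_noncrossing:
  assumes \<pi>: "\<pi> \<in> interval_partitions m" and m: "m \<ge> 1"
  shows "noncrossing (interleave (starts_partition m \<pi>) \<pi>)"
proof (rule noncrossingI)
  let ?J = "block_starts m \<pi>"
  note part = interval_partitionsD(1)[OF \<pi>]
  have bar: "D = ?J" if "D \<in> starts_partition m \<pi>" "x \<in> (\<lambda>k. 2 * k - 1) ` D" "y \<in> (\<lambda>k. 2 * k - 1) ` D" "x < y"
    for D and x y :: nat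
    using that unfolding starts_partition_def by auto
  have mixed: False
    if D: "D \<in> \<pi>" "x \<in> (\<lambda>k. 2 * k) ` D" "y \<in> (\<lambda>k. 2 * k - 1) ` ?J" "z \<in> (\<lambda>k. 2 * k) ` D" "x < y" "y < z"
    for D and x y z :: nat
  proof -
    obtain k j l where *: "k \<in> D" "j \<in> ?J" "l \<in> D" "x = 2 * k" "y = 2 * j - 1" "z = 2 * l"
      using D by blast
    then have "k < j" "j \<le> l" using D by auto
    then show False using interval_block_between(2)[OF \<pi> D(1) *(1,3)] *(2) by blast
  qed
  fix B C and a b c d :: nat
  assume BC: "B \<in> interleave (starts_partition m \<pi>) \<pi>" "C \<in> interleave (starts_partition m \<pi>) \<pi>" "B \<noteq> C"
    and mem: "a \<in> B" "b \<in> C" "c \<in> B" "d \<in> C" and less: "a < b" "b < c" "c < d"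
  show False
    using BC(1)
  proof (cases rule: interleave_cases)
    case D: (bar D)
    then have B: "B = (\<lambda>k. 2 * k - 1) ` ?J" using bar[of D a c] mem less by simp
    show False
      using BC(2)
    proof (cases rule: interleave_cases)
      case E: (bar E)
      then have "C = (\<lambda>k. 2 * k - 1) ` ?J" using bar[of E b d] mem less by simp
      then show False using B BC(3) by simp
    next
      case E: (plain E)
      then show False using mixed[of E b c d] B mem less by simp
    qed
  next
    case D: (plain D)
    show False
      using BC(2)
    proof (cases rule: interleave_cases)
      case E: (bar E)
      then have "C = (\<lambda>k. 2 * k - 1) ` ?J" using bar[of E b d] mem less by simp
      then show False using mixed[of D a b c] D mem less by simp
    next
      case E: (plain E)
      obtain k j l where *: "k \<in> D" "j \<in> E" "l \<in> D" "a = 2 * k" "b = 2 * j" "c = 2 * l"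
        using mem D E by blast
      then have "j \<in> D" using less by (intro interval_block_between(1)[OF \<pi> D(1) *(1,3)]) auto
      then have "D = E" using partition_on_block_unique[OF part D(1) E(1) _ *(2)] by blast
      then show False using D E BC(3) by simp
    qed
  qed
qed

text \<open>
  If \<open>t\<close> is not a start, then \<open>t - 1\<close> and \<open>t\<close> lie in one block of \<open>\<pi>\<close>, which encloses the barred
  \<open>t\<close>. Joining it to any other barred point crosses this block, so it has to stay a singleton.
\<close>

lemma interval_complement_eq:
  assumes \<pi>: "\<pi> \<in> interval_partitions m" and m: "m \<ge> 1"
  shows "interval_complement m \<pi> = starts_partition m \<pi>"
  unfolding interval_complement_def
proof (rule greatest_refinement_eqI)
  let ?J = "block_starts m \<pi>"
  show "starts_partition m \<pi> \<in> {\<sigma> \<in> noncrossing_partitions m. noncrossing (interleave \<sigma> \<pi>)}"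
    using starts_partition_noncrossing[OF m] interleave_starts_noncrossing[OF \<pi> m] by simp
  fix \<tau> assume "\<tau> \<in> {\<sigma> \<in> noncrossing_partitions m. noncrossing (interleave \<sigma> \<pi>)}"
  then have part: "partition_on {1..m} \<tau>" and nc: "noncrossing (interleave \<tau> \<pi>)"
    by (auto simp: noncrossing_partitions_def)
  have "\<exists>C\<in>starts_partition m \<pi>. D \<subseteq> C" if D: "D \<in> \<tau>" for D
  proof (cases "D \<subseteq> ?J")
    case False
    then obtain t where t: "t \<in> D" "t \<notin> ?J" by blast
    have sub: "D \<subseteq> {1..m}" using partition_onD1[OF part] D by blast
    obtain B where B: "B \<in> \<pi>" "t - 1 \<in> B" "t \<in> B" "t > 1"
      using not_block_start[of t m \<pi>] t sub by blast
    \<comment> \<open>In the interleaved order \<open>2(t - 1) < 2t - 1 < 2t\<close> with the outer two points in \<open>B\<close>.\<close>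
    let ?D = "(\<lambda>k. 2 * k - 1) ` D" and ?B = "(\<lambda>k. 2 * k) ` B"
    have blocks: "?D \<in> interleave \<tau> \<pi>" "?B \<in> interleave \<tau> \<pi>"
      using D B(1) unfolding interleave_def by blast+
    have mem: "2 * t - 1 \<in> ?D" "2 * (t - 1) \<in> ?B" "2 * t \<in> ?B" using t B by blast+
    have "?D \<noteq> ?B"
    proof
      assume "?D = ?B"
      then have "2 * t - 1 \<in> ?B" using mem(1) by simp
      then show False using B(4) by auto presburger
    qed
    have "u = t" if u: "u \<in> D" for u
    proof (cases u t rule: linorder_cases)
      case less
      have "2 * u - 1 \<in> ?D" using u by blast
      then have "?D = ?B"
        using less B(4) by (rule_tac noncrossingD[OF nc blocks _ mem(2) mem(1) mem(3)]) auto
      then show ?thesis using \<open>?D \<noteq> ?B\<close> by blast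
    next
      case greater
      have "2 * u - 1 \<in> ?D" using u by blast
      then have "?B = ?D"
        using greater B(4) by (rule_tac noncrossingD[OF nc blocks(2,1) mem(2) mem(1) mem(3)]) auto
      then show ?thesis using \<open>?D \<noteq> ?B\<close> by blast
    qed simp
    then have "D \<subseteq> {t}" by blast
    moreover have "{t} \<in> starts_partition m \<pi>"
      using t sub unfolding starts_partition_def by blast
    ultimately show ?thesis by blast
  qed (auto simp: starts_partition_def)
  then show "refines {1..m} \<tau> (starts_partition m \<pi>)"
    using part starts_partition_noncrossing[OF m]
    by (simp add: refines_def noncrossing_partitions_def)
qed blast

text \<open>
  The value of the closure: a block of \<open>\<pi>\<close> without its start is the gap between two consecutive
  starts, so the gaps can be described without numbering the starts.
\<close>

definition gap_partition :: "nat \<Rightarrow> nat set set \<Rightarrow> nat set set" where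
  "gap_partition m \<pi> = insert (block_starts m \<pi>) ((\<lambda>B. B - block_starts m \<pi>) ` \<pi> - {{}})"

lemma partition_on_gap_partition:
  assumes \<pi>: "\<pi> \<in> interval_partitions m" and m: "m \<ge> 1"
  shows "partition_on {1..m} (gap_partition m \<pi>)"
proof -
  let ?J = "block_starts m \<pi>"
  have "(\<lambda>B. B - ?J) ` \<pi> = (\<inter>) (- ?J) ` \<pi>" by (intro image_cong refl) blast
  moreover have "{1..m} - ?J = - ?J \<inter> {1..m}" by blast
  ultimately have "partition_on ({1..m} - ?J) ((\<lambda>B. B - ?J) ` \<pi> - {{}})"
    using partition_on_restrict[OF interval_partitionsD(1)[OF \<pi>], of "- ?J"] by simp
  then show ?thesis
    unfolding gap_partition_def using block_starts_subset[OF m]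
    by (intro partition_on_insert_complement) (auto simp: block_starts_def)
qed

lemma gap_partition_noncrossing:
  assumes \<pi>: "\<pi> \<in> interval_partitions m" and m: "m \<ge> 1"
  shows "gap_partition m \<pi> \<in> noncrossing_partitions m"
proof -
  let ?J = "block_starts m \<pi>"
  note part = interval_partitionsD(1)[OF \<pi>]
  have between: "y \<notin> ?J" if "B \<in> \<pi>" "x \<in> B - ?J" "z \<in> B - ?J" "x < y" "y < z" for B x y z
    using interval_block_between(2)[OF \<pi> that(1), of x z y] that by auto
  have "noncrossing (gap_partition m \<pi>)"
  proof (rule noncrossingI)
    fix B C and a b c d :: nat
    assume BC: "B \<in> gap_partition m \<pi>" "C \<in> gap_partition m \<pi>" "B \<noteq> C"
      and mem: "a \<in> B" "b \<in> C" "c \<in> B" "d \<in> C" and less: "a < b" "b < c" "c < d"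
    show False
    proof (cases "B = ?J")
      case True
      then obtain E where "E \<in> \<pi>" "C = E - ?J" using BC unfolding gap_partition_def by blast
      then show False using between[of E b d c] True mem less by blast
    next
      case False
      then obtain D where D: "D \<in> \<pi>" "B = D - ?J" using BC unfolding gap_partition_def by blast
      show False
      proof (cases "C = ?J")
        case True
        then show False using between[of D a c b] D mem less by blast
      next
        case False
        then obtain E where E: "E \<in> \<pi>" "C = E - ?J" using BC unfolding gap_partition_def by blast
        have "b \<in> D"
          using interval_block_between(1)[OF \<pi> D(1), of a c b] D(2) mem less by simp
        then have "D = E" using partition_on_block_unique[OF part D(1) E(1)] E(2) mem(2) by blast
        then show False using D E BC(3) by simp
      qed
    qed
  qed
  then show ?thesis
    using partition_on_gap_partition[OF assms] by (simp add: noncrossing_partitions_def)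
qed

text \<open>
  An admissible partition has the set of starts as a block, since the point 1 may not be merged.
  Any other block cannot reach across a start \<open>j\<close>, or it would cross the block of starts at
  \<open>1\<close> and \<open>j\<close>; so it stays inside one block of \<open>\<pi>\<close>.
\<close>

lemma closure_partition_eq:
  assumes \<pi>: "\<pi> \<in> interval_partitions m" and m: "m \<ge> 1"
  shows "closure_partition m (starts_partition m \<pi>) = gap_partition m \<pi>"
proof -
  let ?J = "block_starts m \<pi>" and ?\<kappa> = "starts_partition m \<pi>"
  note part_\<pi> = interval_partitionsD(1)[OF \<pi>]
  have part_\<kappa>: "partition_on {1..m} ?\<kappa>"
    using starts_partition_noncrossing[OF m] by (simp add: noncrossing_partitions_def)
  have first: "first_block ?\<kappa> = ?J"
    using first_block_insert_starts part_\<kappa> unfolding starts_partition_def by blast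
  have single: "{k} \<in> ?\<kappa> \<and> {k} \<noteq> first_block ?\<kappa> \<longleftrightarrow> k \<in> {1..m} - ?J" for k
    unfolding first by (auto simp: starts_partition_def)
  show ?thesis
    unfolding closure_partition_def single
  proof (rule greatest_refinement_eqI)
    have "B \<in> ?\<kappa> \<or> (\<forall>k\<in>B. k \<in> {1..m} - ?J)" if B: "B \<in> gap_partition m \<pi>" for B
    proof (cases "B = ?J")
      case False
      then obtain D where "D \<in> \<pi>" "B = D - ?J" using B unfolding gap_partition_def by blast
      then show ?thesis using partition_onD1[OF part_\<pi>] by blast
    qed (simp add: starts_partition_def)
    then show "gap_partition m \<pi> \<in> {\<sigma> \<in> noncrossing_partitions m. \<forall>B\<in>\<sigma>. B \<in> ?\<kappa> \<or> (\<forall>k\<in>B. k \<in> {1..m} - ?J)}"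
      using gap_partition_noncrossing[OF assms] by simp
    fix \<sigma> assume "\<sigma> \<in> {\<sigma> \<in> noncrossing_partitions m. \<forall>B\<in>\<sigma>. B \<in> ?\<kappa> \<or> (\<forall>k\<in>B. k \<in> {1..m} - ?J)}"
    then have \<sigma>: "\<sigma> \<in> noncrossing_partitions m"
      and blocks: "\<And>B. B \<in> \<sigma> \<Longrightarrow> B \<in> ?\<kappa> \<or> (\<forall>k\<in>B. k \<in> {1..m} - ?J)"
      by blast+
    have part: "partition_on {1..m} \<sigma>" and nc: "noncrossing \<sigma>"
      using \<sigma> by (auto simp: noncrossing_partitions_def)
    have J: "?J \<in> \<sigma>"
    proof -
      have "1 \<in> {1..m}" using m by simp
      then obtain E where E: "E \<in> \<sigma>" "1 \<in> E" using partition_on_obtain_block[OF part] by blast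
      have "1 \<in> ?J" by (simp add: block_starts_def)
      then have "E \<in> ?\<kappa>" using blocks[OF E(1)] E(2) by blast
      then have "E = ?J"
        using partition_on_block_unique[OF part_\<kappa>, of E ?J 1] E(2) \<open>1 \<in> ?J\<close>
        by (simp add: starts_partition_def)
      with E show ?thesis by simp
    qed
    have "\<exists>C\<in>gap_partition m \<pi>. D \<subseteq> C" if D: "D \<in> \<sigma>" for D
    proof (cases "D = ?J")
      case False
      have sub: "D \<subseteq> {1..m} - ?J"
        using blocks[OF D] False by (auto simp: starts_partition_def)
      have "D \<noteq> {}" using partition_onD3[OF part] D by blast
      then obtain k where k: "k \<in> D" by blast
      then have "k \<in> {1..m}" using sub by blast
      then obtain B where B: "B \<in> \<pi>" "k \<in> B" using partition_on_obtain_block[OF part_\<pi>] by blast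
      have no_cut: False if "c \<in> cut_points m \<pi>" "x \<in> D" "y \<in> D" "x \<le> c" "c < y" for c x y
      proof -
        have "Suc c \<in> ?J" using that by (simp add: block_starts_def)
        moreover have "Suc c \<noteq> y" "x \<noteq> 1" "x \<ge> 1"
          using sub that calculation by (auto simp: block_starts_def)
        ultimately have "?J = D"
          using that by (rule_tac noncrossingD[OF nc J D, of 1 x "Suc c" y]) (auto simp: block_starts_def)
        then show False using False by simp
      qed
      have "l \<in> B" if l: "l \<in> D" for l
        unfolding interval_block_iff[OF \<pi> B]
        using no_cut[OF _ k l] no_cut[OF _ l k] l sub by (meson Diff_iff not_le subsetD)
      then have "D \<subseteq> B - ?J" using sub by blast
      moreover from this have "B - ?J \<in> gap_partition m \<pi>"
        using B(1) k unfolding gap_partition_def by blast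
      ultimately show ?thesis by blast
    qed (auto simp: gap_partition_def)
    then show "refines {1..m} \<sigma> (gap_partition m \<pi>)"
      using part partition_on_gap_partition[OF assms] unfolding refines_def by blast
  qed blast
qed

section \<open>The trace of a Hadamard cumulant\<close>

text \<open>
  Here \<open>b\<close> is the start following \<open>a\<close>, with \<open>m + 1\<close> playing this role after the last start. If
  \<open>b = a + 1\<close>, both sides are empty.
\<close>

lemma gap_partition_block_after:
  assumes \<pi>: "\<pi> \<in> interval_partitions m" and m: "m \<ge> 1" and a: "a \<in> block_starts m \<pi>"
    and b: "a < b" "b \<in> insert (m + 1) (block_starts m \<pi>)"
    and gap: "\<And>x. a < x \<Longrightarrow> x < b \<Longrightarrow> x \<notin> block_starts m \<pi>"
  shows "\<Union>{B \<in> gap_partition m \<pi>. B \<noteq> block_starts m \<pi> \<and> a + 1 \<in> B} = {a<..<b}"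
proof (intro equalityI subsetI)
  let ?J = "block_starts m \<pi>"
  note part = interval_partitionsD(1)[OF \<pi>]
  fix t assume "t \<in> \<Union>{B \<in> gap_partition m \<pi>. B \<noteq> ?J \<and> a + 1 \<in> B}"
  then obtain D where D: "D \<in> \<pi>" "t \<in> D - ?J" "a + 1 \<in> D - ?J"
    unfolding gap_partition_def by blast
  have "t \<in> {1..m}" using partition_onD1[OF part] D(1,2) by blast
  have "a < t"
  proof (rule ccontr)
    assume "\<not> a < t"
    then have "t < a" using D(2) a by (metis DiffD2 linorder_neqE_nat)
    then show False using interval_block_between(2)[OF \<pi> D(1), of t "a + 1" a] D a by auto
  qed
  moreover have "t < b"
  proof (rule ccontr)
    assume "\<not> t < b"
    then have "b \<in> ?J" "b \<le> t" using b(2) \<open>t \<in> {1..m}\<close> by auto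
    moreover have "a + 1 < b" using b(1) D(3) \<open>b \<in> ?J\<close> by (metis DiffD2 Suc_eq_plus1 Suc_lessI)
    ultimately show False using interval_block_between(2)[OF \<pi> D(1), of "a + 1" t b] D by auto
  qed
  ultimately show "t \<in> {a<..<b}" by simp
next
  let ?J = "block_starts m \<pi>"
  note part = interval_partitionsD(1)[OF \<pi>]
  fix t assume "t \<in> {a<..<b}"
  then have t: "a < t" "t < b" by simp_all
  have b_le: "b \<le> m + 1" using b(2) block_starts_subset[OF m, of \<pi>] by force
  then have in_range: "a + 1 \<in> {1..m}" "t \<in> {1..m}" using t by auto
  obtain D where D: "D \<in> \<pi>" "a + 1 \<in> D" using partition_on_obtain_block[OF part in_range(1)] by blast
  have "c < a + 1 \<longleftrightarrow> c < t" if "c \<in> cut_points m \<pi>" for c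
  proof
    assume "c < t"
    have "Suc c \<in> ?J" using that by (simp add: block_starts_def)
    then have "\<not> (a < Suc c \<and> Suc c < b)" using gap by blast
    then show "c < a + 1" using \<open>c < t\<close> t by auto
  qed (use t in auto)
  then have "t \<in> D" unfolding interval_block_iff[OF \<pi> D] using in_range(2) by blast
  moreover have "t \<notin> ?J" "a + 1 \<notin> ?J" using gap t by auto
  ultimately have "t \<in> D - ?J" "a + 1 \<in> D - ?J" "D - ?J \<noteq> ?J" using D a by blast+
  then show "t \<in> \<Union>{B \<in> gap_partition m \<pi>. B \<noteq> ?J \<and> a + 1 \<in> B}"
    using D(1) unfolding gap_partition_def by blast
qed

lemma sum_PiE_Suc:
  fixes f :: "(nat \<Rightarrow> 'n::finite) \<Rightarrow> 'b::comm_monoid_add"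
  shows "(\<Sum>i\<in>{0..Suc k} \<rightarrow>\<^sub>E UNIV. f i) = (\<Sum>i\<in>{0..k} \<rightarrow>\<^sub>E UNIV. \<Sum>z\<in>UNIV. f (i(Suc k := z)))"
proof -
  have "Suc k \<notin> {0..k}" "{0..Suc k} = insert (Suc k) {0..k}"
    by (simp_all add: atLeastAtMostSuc_conv)
  then have "(\<Sum>i\<in>{0..Suc k} \<rightarrow>\<^sub>E UNIV. f i) =
      (\<Sum>(z, i)\<in>UNIV \<times> ({0..k} \<rightarrow>\<^sub>E UNIV). f (i(Suc k := z)))"
    using inj_combinator[of "Suc k" "{0..k}" "\<lambda>_. UNIV :: 'n set"]
    by (simp add: PiE_insert_eq sum.reindex case_prod_unfold)
  then show ?thesis by (subst sum.swap) (simp add: sum.cartesian_product)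
qed

text \<open>
  The sum of the weights of all paths with \<open>k\<close> steps that end at \<open>y\<close> and are constant across every
  position outside \<open>S\<close>, computed step by step. The step numbered \<open>Suc k\<close> leads from position \<open>k + 1\<close> to
  position \<open>k + 2\<close> of the partition.
\<close>

fun transfer_sum :: "complex^'n::finite^'n \<Rightarrow> nat set \<Rightarrow> nat \<Rightarrow> 'n \<Rightarrow> complex" where
  "transfer_sum A S 0 y = 1"
| "transfer_sum A S (Suc k) y =
    (if Suc k \<in> S then \<Sum>x\<in>UNIV. transfer_sum A S k x * A $ x $ y else transfer_sum A S k y * A $ y $ y)"

text \<open>
  Extending a path by the end point \<open>y\<close> multiplies its weight by one entry of \<open>A\<close>. At a cut the
  previous point is free and is summed over, elsewhere it has to be \<open>y\<close>.
\<close>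

lemma sum_constant_paths:
  "(\<Sum>i | i \<in> {0..k} \<rightarrow>\<^sub>E UNIV \<and> (\<forall>c\<in>{1..k} - S. i (c - 1) = i c) \<and> i k = y.
      \<Prod>q<k. A $ i q $ i (Suc q)) = transfer_sum A S k y"
proof (induction k arbitrary: y)
  case 0
  have "{i \<in> {0..0::nat} \<rightarrow>\<^sub>E UNIV. i 0 = y} = {\<lambda>q. if q = 0 then y else undefined}"
    by (auto simp: PiE_iff extensional_def fun_eq_iff)
  then show ?case by simp
next
  case (Suc k)
  let ?P = "\<lambda>k. {0..k} \<rightarrow>\<^sub>E (UNIV :: 'a set)"
  let ?C = "\<lambda>k i. \<forall>c\<in>{1..k} - S. i (c - 1) = i c"
  let ?w = "\<lambda>k i. \<Prod>q<k. A $ i q $ i (Suc q)"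
  have C: "?C (Suc k) (i(Suc k := z)) \<longleftrightarrow> ?C k i \<and> (Suc k \<in> S \<or> i k = z)" for i and z :: 'a
  proof -
    let ?i = "i(Suc k := z)"
    have "(\<forall>c\<in>{1..Suc k} - S. P c) \<longleftrightarrow> (\<forall>c\<in>{1..k} - S. P c) \<and> (Suc k \<in> S \<or> P (Suc k))" for P
      by (auto simp: atLeastAtMostSuc_conv)
    then have "?C (Suc k) ?i \<longleftrightarrow> (\<forall>c\<in>{1..k} - S. ?i (c - 1) = ?i c) \<and> (Suc k \<in> S \<or> ?i (Suc k - 1) = ?i (Suc k))"
      .
    also have "(\<forall>c\<in>{1..k} - S. ?i (c - 1) = ?i c) \<longleftrightarrow> ?C k i"
      by (rule ball_cong) auto
    finally show ?thesis by simp
  qed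
  have w: "?w (Suc k) (i(Suc k := z)) = ?w k i * A $ i k $ z" for i and z :: 'a
    by simp
  have IH: "transfer_sum A S k z = (\<Sum>i\<in>?P k. if ?C k i \<and> i k = z then ?w k i else 0)" for z
    unfolding Suc.IH[symmetric] by (subst sum.inter_filter) (auto intro: finite_PiE)
  have "(\<Sum>i | i \<in> ?P (Suc k) \<and> ?C (Suc k) i \<and> i (Suc k) = y. ?w (Suc k) i) =
      (\<Sum>i\<in>?P (Suc k). if ?C (Suc k) i \<and> i (Suc k) = y then ?w (Suc k) i else 0)"
    by (subst sum.inter_filter) (auto intro: finite_PiE)
  also have "\<dots> = (\<Sum>i\<in>?P k. \<Sum>z\<in>UNIV. if z = y then
      (if ?C k i \<and> (Suc k \<in> S \<or> i k = y) then ?w k i * A $ i k $ y else 0) else 0)"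
    unfolding sum_PiE_Suc C w by (intro sum.cong refl) auto
  also have "\<dots> = (\<Sum>i\<in>?P k. if ?C k i \<and> (Suc k \<in> S \<or> i k = y) then ?w k i * A $ i k $ y else 0)"
    by (simp add: sum.delta)
  also have "\<dots> = transfer_sum A S (Suc k) y"
  proof (cases "Suc k \<in> S")
    case True
    have "(\<Sum>x\<in>UNIV. transfer_sum A S k x * A $ x $ y) =
        (\<Sum>i\<in>?P k. \<Sum>x\<in>UNIV. if x = i k then (if ?C k i then ?w k i * A $ i k $ y else 0) else 0)"
      unfolding IH sum_distrib_right by (subst sum.swap) (intro sum.cong refl, auto)
    also have "\<dots> = (\<Sum>i\<in>?P k. if ?C k i then ?w k i * A $ i k $ y else 0)"
      by (simp add: sum.delta)
    finally show ?thesis using True by simp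
  next
    case False
    have "transfer_sum A S k y * A $ y $ y = (\<Sum>i\<in>?P k. if ?C k i \<and> i k = y then ?w k i * A $ i k $ y else 0)"
      unfolding IH sum_distrib_right by (intro sum.cong refl) auto
    then show ?thesis using False by simp
  qed
  finally show ?case .
qed

lemma transfer_gap:
  assumes "\<And>c. k < c \<Longrightarrow> c \<le> k + d \<Longrightarrow> c \<notin> S"
  shows "transfer_sum A S (k + d) y = transfer_sum A S k y * A $ y $ y ^ d"
  using assms by (induction d) auto

lemma diagonal_expectation_nth:
  "diagonal_expectation C $ x $ y = (if x = y then C $ x $ x else 0)"
proof -
  have "(unit_projection k ** C ** unit_projection k) $ x $ y =
      (if k = x then (if x = y then C $ x $ x else 0) else 0)" for k
  proof -
    have 1: "(unit_projection k ** C) $ x $ z = (if x = k then C $ k $ z else 0)" for z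
      by (cases "x = k") (simp_all add: matrix_matrix_mult_def unit_projection_def
          if_distrib[of "\<lambda>x. x * _"] sum.delta cong: if_cong)
    have 2: "(M ** unit_projection k) $ x $ y = (if y = k then M $ x $ k else 0)" for M
      by (cases "y = k") (simp_all add: matrix_matrix_mult_def unit_projection_def
          if_distrib[of "\<lambda>x. _ * x"] sum.delta cong: if_cong)
    show ?thesis unfolding 2 1 by auto
  qed
  then show ?thesis by (simp add: diagonal_expectation_def sum.delta)
qed

lemma hadamard_prod_diagonal_nth:
  assumes "\<And>t. t \<in> G \<Longrightarrow> F t = A"
  shows "(if G = {} then mat 1 else diagonal_expectation (hadamard_prod F G)) $ x $ y =
    (if x = y then A $ x $ x ^ card G else 0)"
proof -
  have "(\<Prod>t\<in>G. F t $ x $ x) = A $ x $ x ^ card G"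
    using assms by (simp cong: prod.cong)
  then show ?thesis
    by (cases "x = y") (simp_all add: diagonal_expectation_nth hadamard_prod_def mat_def)
qed

text \<open>
  Multiplying a partial product by the diagonal matrix \<open>H\<^sub>s\<close> performs all the steps of the transfer
  recursion inside the \<open>s\<close>-th block at once, and multiplying it by the next copy of \<open>A\<close> performs the step
  at the following cut. The leading matrix of ones is the initial value 1 of the recursion, in
  each row, so that every row of a partial product is the same vector of transfer sums.
\<close>

lemma trace_hadamard_cumulant:
  assumes \<pi>: "\<pi> \<in> interval_partitions (r + 1)"
  shows "trace (hadamard_cumulant (closure_partition (r + 1) (interval_complement (r + 1) \<pi>))
      (ones_matrix # replicate r A)) =
    (\<Sum>y\<in>UNIV. transfer_sum A (cut_points (r + 1) \<pi>) r y)"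
proof -
  let ?m = "r + 1" and ?S = "cut_points (r + 1) \<pi>"
  define J where "J = block_starts ?m \<pi>"
  define p where "p = card J"
  define j where "j s = sorted_list_of_set J ! s" for s
  define F where "F t = (ones_matrix # replicate r A) ! (t - 1)" for t
  define \<sigma> where "\<sigma> = gap_partition ?m \<pi>"
  define G where "G s = \<Union>{B \<in> \<sigma>. B \<noteq> J \<and> j s + 1 \<in> B}" for s
  define H where "H s = (if G s = {} then mat 1 else diagonal_expectation (hadamard_prod F (G s)))" for s
  define next_start where "next_start s = (if Suc s < p then j (Suc s) else ?m + 1)" for s
  define L where "L q = matrix_prod (concat (map (\<lambda>s. [F (j s), H s]) [0..<q]))" for q
  let ?R = "transfer_sum A ?S"

  have m: "?m \<ge> 1" by simp
  have J_sub: "J \<subseteq> {1..?m}" unfolding J_def by (rule block_starts_subset[OF m])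
  then have fin: "finite J" by (rule finite_subset) simp
  have "1 \<in> J" by (simp add: J_def block_starts_def)
  then have p: "p > 0" using fin by (auto simp: p_def card_gt_0_iff)
  have len: "length (sorted_list_of_set J) = p" by (simp add: p_def)
  have j_mem: "j s \<in> J" if "s < p" for s
    using nth_mem[of s "sorted_list_of_set J"] that len fin by (simp add: j_def)
  have j_ex: "\<exists>s<p. x = j s" if "x \<in> J" for x
    using that fin len by (metis in_set_conv_nth j_def set_sorted_list_of_set)
  have j_less: "j s < j t" if "s < t" "t < p" for s t
    using that len strict_sorted_list_of_set[of J] unfolding j_def
    by (simp add: sorted_wrt_nth_less)
  have j0: "j 0 = 1"
  proof -
    obtain s where "s < p" "1 = j s" using j_ex[OF \<open>1 \<in> J\<close>] by blast
    moreover have "j 0 \<ge> 1" using j_mem[OF p] J_sub by auto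
    ultimately show ?thesis using j_less[of 0 s] by (cases "s = 0") auto
  qed
  have next_mem: "next_start s \<in> insert (?m + 1) J" for s
    unfolding next_start_def using j_mem by auto
  have j_le: "j s \<le> ?m" if "s < p" for s
    using j_mem[OF that] J_sub by auto
  have next_gt: "j s < next_start s" if "s < p" for s
    unfolding next_start_def using j_less[of s "Suc s"] j_le[OF that] by auto
  have no_start: "x \<notin> J" if x: "s < p" "j s < x" "x < next_start s" for s x
  proof
    assume "x \<in> J"
    then obtain t where t: "t < p" "x = j t" using j_ex by blast
    have "\<not> t \<le> s" using j_less[of t s] x t by (metis le_less less_asym less_irrefl)
    then have "Suc s \<le> t" "Suc s < p" using t(1) by auto
    then have "next_start s \<le> j t"
      using j_less[of "Suc s" t] t(1) by (cases "Suc s = t") (auto simp: next_start_def)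
    then show False using x(3) t(2) by simp
  qed
  have G: "G s = {j s<..<next_start s}" if "s < p" for s
    unfolding G_def \<sigma>_def J_def
    by (rule gap_partition_block_after[OF \<pi> m])
      (use j_mem[OF that] next_gt[OF that] next_mem[of s] no_start[OF that] in \<open>simp_all add: J_def\<close>)
  have F: "F t = A" if "t > 1" "t \<le> ?m" for t
    using that by (cases t) (auto simp: F_def nth_Cons split: nat.split)
  have H: "H s $ x $ y = (if x = y then A $ x $ x ^ (next_start s - j s - 1) else 0)" if s: "s < p" for s x y
  proof -
    have "next_start s \<le> ?m + 1" using j_le[of "Suc s"] by (auto simp: next_start_def)
    moreover have "j s \<ge> 1" using j_mem[OF s] J_sub by auto
    ultimately have "F t = A" if "t \<in> G s" for t
      using that G[OF s] by (intro F) auto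
    then show ?thesis
      using hadamard_prod_diagonal_nth[of "G s" F A] G[OF s] unfolding H_def by simp
  qed
  \<comment> \<open>Index shift: \<open>transfer_sum A S k\<close> has reached position \<open>k + 1\<close>, so position \<open>next_start s - 1\<close>, the last one
    of the block, belongs to \<open>next_start s - 2\<close>.\<close>
  have gap: "?R (next_start s - 2) x = ?R (j s - 1) x * A $ x $ x ^ (next_start s - j s - 1)" if s: "s < p" for s x
  proof -
    have "j s \<ge> 1" using j_mem[OF s] J_sub by auto
    then have "j s - 1 + (next_start s - j s - 1) = next_start s - 2" using next_gt[OF s] by simp
    moreover have "c \<notin> ?S" if "j s - 1 < c" "c \<le> j s - 1 + (next_start s - j s - 1)" for c
    proof
      assume "c \<in> ?S"
      then have "Suc c \<in> J" by (simp add: J_def block_starts_def)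
      then show False using no_start[OF s, of "Suc c"] that \<open>j s \<ge> 1\<close> by auto
    qed
    ultimately show ?thesis using transfer_gap[of "j s - 1" "next_start s - j s - 1" ?S A x] by simp
  qed
  have LH: "((L q ** F (j q)) ** H q) $ x $ y = ?R (next_start q - 2) y"
    if q: "q < p" and L: "\<And>x y. (L q ** F (j q)) $ x $ y = ?R (j q - 1) y" for q x y
    unfolding gap[OF q]
    by (simp add: matrix_matrix_mult_def[of _ "H q"] L H[OF q] if_distrib[of "\<lambda>x. _ * x"]
        sum.delta' cong: if_cong)
  have L: "(L q ** F (j q)) $ x $ y = ?R (j q - 1) y" if "q < p" for q x y
    using that
  proof (induction q arbitrary: x y)
    case 0
    have "L 0 = mat 1" by (simp add: L_def)
    then show ?case by (simp add: j0 F_def ones_matrix_def)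
  next
    case (Suc q)
    then have q: "q < p" and IH: "\<And>x y. (L q ** F (j q)) $ x $ y = ?R (j q - 1) y" by simp_all
    have next_q: "next_start q = j (Suc q)" using Suc.prems by (simp add: next_start_def)
    have start: "j (Suc q) > 1" using j_less[of 0 "Suc q"] j0 Suc.prems by simp
    then have FA: "F (j (Suc q)) = A" using F j_le[OF Suc.prems] by blast
    define k where "k = j (Suc q) - 2"
    then have k: "j (Suc q) = Suc (Suc k)" using start by simp
    have "j (Suc q) \<in> J" by (rule j_mem[OF Suc.prems])
    then have cut: "Suc k \<in> ?S" unfolding k J_def block_starts_def by auto
    have "L (Suc q) = (L q ** F (j q)) ** H q"
      by (simp add: L_def matrix_prod_append matrix_mul_assoc)
    then have "(L (Suc q) ** F (j (Suc q))) $ x $ y = (\<Sum>z\<in>UNIV. ?R k z * A $ z $ y)"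
      using LH[OF q IH] by (simp add: matrix_matrix_mult_def[of _ A] FA[unfolded k] next_q k)
    also have "\<dots> = ?R (Suc k) y"
      using cut by simp
    finally show ?case by (simp add: k)
  qed
  have diagonal_H: "(diagonal_expectation M ** H q) $ y $ y = (M ** H q) $ y $ y" if "q < p" for M q y
    by (simp add: matrix_matrix_mult_def[of _ "H q"] diagonal_expectation_nth H[OF that]
        if_distrib[of "\<lambda>x. _ * x"] sum.delta' cong: if_cong)
  have part: "partition_on {1..?m} \<sigma>"
    unfolding \<sigma>_def by (rule partition_on_gap_partition[OF \<pi> m])
  have closure: "closure_partition ?m (interval_complement ?m \<pi>) = \<sigma>"
    unfolding \<sigma>_def interval_complement_eq[OF \<pi> m] by (rule closure_partition_eq[OF \<pi> m])
  have first: "first_block \<sigma> = J"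
    using part unfolding \<sigma>_def J_def gap_partition_def by (rule first_block_insert_starts)
  have "hadamard_cumulant \<sigma> (ones_matrix # replicate r A) =
      diagonal_expectation (L (p - 1) ** F (j (p - 1))) ** H (p - 1)"
    unfolding hadamard_cumulant_def Let_def first
      L_def H_def G_def F_def j_def p_def matrix_prod_append matrix_prod_simps matrix_mul_rid
    by (rule refl)
  moreover have last: "p - 1 < p" "next_start (p - 1) - 2 = r" using p by (simp_all add: next_start_def)
  have "(diagonal_expectation (L (p - 1) ** F (j (p - 1))) ** H (p - 1)) $ y $ y = ?R r y" for y
  proof -
    let ?M = "L (p - 1) ** F (j (p - 1))"
    have "(diagonal_expectation ?M ** H (p - 1)) $ y $ y = (?M ** H (p - 1)) $ y $ y"
      by (rule diagonal_H[OF last(1)])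
    also have "\<dots> = ?R r y"
      using LH[OF last(1) L[OF last(1)]] last(2) by simp
    finally show ?thesis .
  qed
  ultimately show ?thesis
    unfolding closure trace_def by simp
qed

section \<open>Cumulants of the quadratic form\<close>

lemma path_weight_prod: "path_weight A r i = (\<Prod>q<r. A $ i q $ i (Suc q))"
  unfolding path_weight_eq path_steps_def
  by (induction r) simp_all

text \<open>
  Refining the kernel of \<open>i\<close> means that \<open>i\<close> is constant on blocks, hence that it does not change across
  the points that are not cuts; grouping the paths by their end point gives the transfer sums.
\<close>

lemma sum_paths_constant_on_blocks:
  assumes \<pi>: "\<pi> \<in> interval_partitions (r + 1)"
  shows "(\<Sum>i | i \<in> {0..r} \<rightarrow>\<^sub>E UNIV \<and> refines {1..r + 1} \<pi> (ker_partition r i). path_weight A r i) =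
    (\<Sum>y\<in>UNIV. transfer_sum A (cut_points (r + 1) \<pi>) r y)"
proof -
  let ?S = "cut_points (r + 1) \<pi>"
  let ?I = "{i \<in> {0..r} \<rightarrow>\<^sub>E UNIV. \<forall>c\<in>{1..r} - ?S. i (c - 1) = i c}"
  have "refines {1..r + 1} \<pi> (ker_partition r i) \<longleftrightarrow> (\<forall>c\<in>{1..r} - ?S. i (c - 1) = i c)" for i :: "nat \<Rightarrow> 'a"
    using refines_ker_partition_iff[OF \<pi>, of i] constant_on_blocks_iff[OF \<pi>, of "\<lambda>k. i (k - 1)"]
    by (simp add: atLeastLessThanSuc_atLeastAtMost)
  then have "(\<Sum>i | i \<in> {0..r} \<rightarrow>\<^sub>E UNIV \<and> refines {1..r + 1} \<pi> (ker_partition r i). path_weight A r i) =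
      (\<Sum>i\<in>?I. \<Prod>q<r. A $ i q $ i (Suc q))"
    by (simp only: path_weight_prod)
  also have "\<dots> = (\<Sum>y\<in>UNIV. \<Sum>i\<in>{i \<in> ?I. i r = y}. \<Prod>q<r. A $ i q $ i (Suc q))"
    by (rule sum.group[symmetric]) (auto intro: finite_subset[OF _ finite_PiE[of "{0..r}" "\<lambda>_. UNIV"]])
  also have "\<dots> = (\<Sum>y\<in>UNIV. transfer_sum A ?S r y)"
    by (intro sum.cong refl) (simp add: sum_constant_paths[symmetric] conj_assoc)
  finally show ?thesis .
qed

text \<open>
  Multilinearity expands the cumulant over lists of index pairs, the product formula turns it
  into sums of cumulants of the \<open>X\<^sub>i\<close>, and only the lists of steps of a path contribute.
\<close>

lemma cumulant1_quadratic_form: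
  fixes smul :: "complex \<Rightarrow> 'a::ring_1 \<Rightarrow> 'a" and X :: "'n::finite \<Rightarrow> 'a"
  assumes "nc_prob_space smul star \<phi>"
    and ind: "boolean_independent smul \<phi> X"
    and r: "r \<ge> 1"
  shows "cumulant1 \<phi> r (quadratic_form smul A X) =
    (\<Sum>i\<in>{0..r} \<rightarrow>\<^sub>E UNIV. path_weight A r i *
       restricted_moment \<phi> {c. odd c} (map X (path_word r i)))"
proof -
  interpret nc_prob_space smul star \<phi> by fact
  let ?c = "\<lambda>(j, k). A $ j $ k" and ?D = "restricted_moment \<phi> {c. odd c}"
  have "quadratic_form smul A X = (\<Sum>e\<in>UNIV. smul (?c e) ((\<lambda>(j, k). X j * X k) e))"
    unfolding quadratic_form_def by (simp add: sum.cartesian_product case_prod_unfold flip: UNIV_Times_UNIV)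
  then have "cumulant1 \<phi> r (quadratic_form smul A X) =
      (\<Sum>es | length es = r. prod_list (map ?c es) * boolean_cumulant \<phi> (map (\<lambda>(j, k). X j * X k) es))"
    unfolding cumulant1_def by (simp only: boolean_cumulant_replicate_sum)
  also have "\<dots> = (\<Sum>es | length es = r. prod_list (map ?c es) * ?D (map X (flatten_pairs es)))"
  proof (rule sum.cong[OF refl])
    fix es :: "('n \<times> 'n) list" assume "es \<in> {es. length es = r}"
    then have "map (\<lambda>(i, j). (X i, X j)) es \<noteq> []" using r by auto
    from boolean_cumulant_products[of \<phi>, OF state_one this]
    show "prod_list (map ?c es) * boolean_cumulant \<phi> (map (\<lambda>(j, k). X j * X k) es) =
        prod_list (map ?c es) * ?D (map X (flatten_pairs es))"
      by (simp add: map_flatten_pairs case_prod_unfold comp_def)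
  qed
  also have "\<dots> = (\<Sum>i\<in>{0..r} \<rightarrow>\<^sub>E UNIV.
      prod_list (map ?c (path_steps r i)) * ?D (map X (flatten_pairs (path_steps r i))))"
    using restricted_moment_not_path_zero[OF ind state_one] by (intro sum_path_steps[OF r]) auto
  finally show ?thesis by (simp only: path_weight_eq flatten_path_steps)
qed

lemma length_path_word [simp]: "length (path_word r i) = 2 * r"
  by (simp add: path_word_def)

text \<open>
  The letter at position \<open>s\<close> of the path word is \<open>i\<close> at \<open>s div 2\<close>, so the word is constant on the blocks
  of the hat of \<open>\<pi>\<close> exactly when \<open>i\<close> is constant on the blocks of \<open>\<pi>\<close>. In the other case the
  cumulant is mixed.
\<close>

lemma restricted_moment_path_word:
  fixes smul :: "complex \<Rightarrow> 'a::ring_1 \<Rightarrow> 'a" and X :: "'n::finite \<Rightarrow> 'a"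
  assumes one: "\<phi> 1 = 1" and ind: "boolean_independent smul \<phi> X" and r: "r \<ge> 1"
    and x: "\<And>i. identically_distributed \<phi> x (X i)"
  shows "restricted_moment \<phi> {c. odd c} (map X (path_word r i)) =
    (\<Sum>\<pi> | \<pi> \<in> interval_partitions (r + 1) \<and> refines {1..r + 1} \<pi> (ker_partition r i).
       cumulant1_partition \<phi> (hat_partition r \<pi>) x)"
proof -
  have hat_term: "cumulant_partition \<phi> (hat_partition r \<pi>) (map X (path_word r i)) =
      (if refines {1..r + 1} \<pi> (ker_partition r i) then cumulant1_partition \<phi> (hat_partition r \<pi>) x else 0)"
    if \<pi>: "\<pi> \<in> interval_partitions (r + 1)" for \<pi>
  proof -
    let ?w = "path_word r i"
    note hat = hat_partition_interval[OF r \<pi>]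
    have hat': "hat_partition r \<pi> \<in> interval_partitions (length ?w)" using hat by simp
    have pos: "?w ! (s - 1) = i (s div 2)" if "s \<in> {1..2 * r}" for s
      using that by (auto simp: path_word_def)
    have "(\<forall>B\<in>hat_partition r \<pi>. \<forall>k\<in>B. \<forall>l\<in>B. ?w ! (k - 1) = ?w ! (l - 1)) \<longleftrightarrow>
        (\<forall>c\<in>{1..<2 * r} - cut_points (2 * r) (hat_partition r \<pi>). i (c div 2) = i (Suc c div 2))"
      unfolding constant_on_blocks_iff[OF hat, of "\<lambda>k. ?w ! (k - 1)"]
    proof (intro ball_cong refl)
      fix c assume "c \<in> {1..<2 * r} - cut_points (2 * r) (hat_partition r \<pi>)"
      then show "?w ! (c - 1) = ?w ! (Suc c - 1) \<longleftrightarrow> i (c div 2) = i (Suc c div 2)"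
        using pos[of c] pos[of "Suc c"] by simp
    qed
    also have "\<dots> \<longleftrightarrow> (\<forall>c\<in>{1..<r + 1} - cut_points (r + 1) \<pi>. i (c - 1) = i (Suc c - 1))"
    proof safe
      fix c assume *: "\<forall>c\<in>{1..<2 * r} - cut_points (2 * r) (hat_partition r \<pi>). i (c div 2) = i (Suc c div 2)"
        and c: "c \<in> {1..<r + 1}" "c \<notin> cut_points (r + 1) \<pi>"
      have "x = c" if "x \<in> cut_points (r + 1) \<pi>" "2 * c - 1 = 2 * x - 1" for x
        using that(2) subsetD[OF cut_points_subset that(1)] c(1) by auto
      then have "2 * c - 1 \<notin> cut_points (2 * r) (hat_partition r \<pi>)"
        unfolding cut_points_hat_partition[OF r \<pi>] using c(2) by blast
      moreover have "2 * c - 1 \<in> {1..<2 * r}" "(2 * c - 1) div 2 = c - 1" "Suc (2 * c - 1) div 2 = c"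
        using c(1) by auto
      ultimately show "i (c - 1) = i (Suc c - 1)" using *[rule_format, of "2 * c - 1"] by simp
    next
      fix c assume *: "\<forall>c\<in>{1..<r + 1} - cut_points (r + 1) \<pi>. i (c - 1) = i (Suc c - 1)"
        and c: "c \<in> {1..<2 * r}" "c \<notin> cut_points (2 * r) (hat_partition r \<pi>)"
      show "i (c div 2) = i (Suc c div 2)"
      proof (cases "even c")
        case False
        then obtain d where d: "c = 2 * d + 1" by (rule oddE)
        then have "c = 2 * Suc d - 1" by simp
        then have "Suc d \<notin> cut_points (r + 1) \<pi>"
          using c(2) unfolding cut_points_hat_partition[OF r \<pi>] by blast
        then show ?thesis using *[rule_format, of "Suc d"] c(1) d by simp
      qed simp
    qed
    also have "\<dots> \<longleftrightarrow> refines {1..r + 1} \<pi> (ker_partition r i)"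
      unfolding refines_ker_partition_iff[OF \<pi>] constant_on_blocks_iff[OF \<pi>, of "\<lambda>k. i (k - 1)"] ..
    finally have const: "(\<forall>B\<in>hat_partition r \<pi>. \<forall>k\<in>B. \<forall>l\<in>B. ?w ! (k - 1) = ?w ! (l - 1)) \<longleftrightarrow>
        refines {1..r + 1} \<pi> (ker_partition r i)" .
    show ?thesis
    proof (cases "refines {1..r + 1} \<pi> (ker_partition r i)")
      case True
      then show ?thesis
        using cumulant_partition_identically_distributed[of \<phi> x X, OF x hat' iffD2[OF const True]]
        by simp
    next
      case False
      then show ?thesis
        using cumulant_partition_mixed_zero[OF ind one hat', unfolded const] by simp
    qed
  qed
  have "restricted_moment \<phi> {c. odd c} (map X (path_word r i)) =
      (\<Sum>\<pi>\<in>interval_partitions (r + 1). cumulant_partition \<phi> (hat_partition r \<pi>) (map X (path_word r i)))"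
    unfolding restricted_moment_def
    using sum.reindex_bij_betw[OF bij_betw_hat_partition[OF r],
        of "\<lambda>\<sigma>. cumulant_partition \<phi> \<sigma> (map X (path_word r i))"] by simp
  also have "\<dots> = (\<Sum>\<pi>\<in>interval_partitions (r + 1).
      if refines {1..r + 1} \<pi> (ker_partition r i) then cumulant1_partition \<phi> (hat_partition r \<pi>) x else 0)"
    by (rule sum.cong[OF refl hat_term])
  finally show ?thesis
    by (simp only: sum.inter_filter finite_interval_partitions)
qed

theorem proposition3p6:
  fixes smul :: "complex \<Rightarrow> 'a::ring_1 \<Rightarrow> 'a"
    and star :: "'a \<Rightarrow> 'a"
    and \<phi> :: "'a \<Rightarrow> complex"
    and X :: "'n::finite \<Rightarrow> 'a"
    and A :: "complex^'n^'n"
    and r :: nat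
  assumes "nc_prob_space smul star \<phi>"
    and "\<And>i. star (X i) = X i"
    and "boolean_independent smul \<phi> X"
    and "self_adjoint_matrix A"
    and "r \<ge> 1"
  shows "cumulant1 \<phi> r (quadratic_form smul A X) =
      (\<Sum>i\<in>{0..r} \<rightarrow>\<^sub>E (UNIV :: 'n set). path_weight A r i *
        (\<Sum>\<pi> | \<pi> \<in> interval_partitions (2 * r) \<and>
               interval_join (2 * r) \<pi> (pair_partition r) = one_partition (2 * r).
           cumulant_partition \<phi> \<pi>
             (X (i 0) # concat (map (\<lambda>k. [X (i k), X (i k)]) [1..<r]) @ [X (i r)])))
    \<and> ((\<forall>i j. identically_distributed \<phi> (X i) (X j)) \<longrightarrow>
       (\<forall>x. star x = x \<and> (\<forall>i. identically_distributed \<phi> x (X i)) \<longrightarrow>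
          cumulant1 \<phi> r (quadratic_form smul A X) =
            (\<Sum>\<pi>\<in>interval_partitions (r + 1).
              \<Sum>i | i \<in> {0..r} \<rightarrow>\<^sub>E (UNIV :: 'n set) \<and> refines {1..r + 1} \<pi> (ker_partition r i).
                path_weight A r i * cumulant1_partition \<phi> (hat_partition r \<pi>) x) \<and>
          cumulant1 \<phi> r (quadratic_form smul A X) =
            (\<Sum>\<pi>\<in>interval_partitions (r + 1).
              trace (hadamard_cumulant (closure_partition (r + 1) (interval_complement (r + 1) \<pi>))
                       (ones_matrix # replicate r A))
              * cumulant1_partition \<phi> (hat_partition r \<pi>) x)))"
proof -
  let ?K = "cumulant1 \<phi> r (quadratic_form smul A X)" and ?I = "{0..r} \<rightarrow>\<^sub>E (UNIV :: 'n set)"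
  let ?D = "\<lambda>i. restricted_moment \<phi> {c. odd c} (map X (path_word r i))"
  note K = cumulant1_quadratic_form[OF assms(1,3,5), of A]
  have one: "\<phi> 1 = 1" using assms(1) by (rule nc_prob_space.state_one)
  have D: "?D i = (\<Sum>\<pi> | \<pi> \<in> interval_partitions (2 * r) \<and>
               interval_join (2 * r) \<pi> (pair_partition r) = one_partition (2 * r).
           cumulant_partition \<phi> \<pi>
             (X (i 0) # concat (map (\<lambda>k. [X (i k), X (i k)]) [1..<r]) @ [X (i r)]))" for i
    unfolding restricted_moment_def map_path_word[OF assms(5), symmetric]
    using interval_join_pair_partition_eq_one_iff[OF _ assms(5)]
    by (intro sum.cong Collect_cong) (auto simp: subset_iff)
  have by_paths: "?K = (\<Sum>\<pi>\<in>interval_partitions (r + 1).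
        \<Sum>i | i \<in> ?I \<and> refines {1..r + 1} \<pi> (ker_partition r i).
          path_weight A r i * cumulant1_partition \<phi> (hat_partition r \<pi>) x)"
    if x: "\<And>i. identically_distributed \<phi> x (X i)" for x
  proof -
    have "?K = (\<Sum>i\<in>?I. \<Sum>\<pi> | \<pi> \<in> interval_partitions (r + 1) \<and> refines {1..r + 1} \<pi> (ker_partition r i).
        path_weight A r i * cumulant1_partition \<phi> (hat_partition r \<pi>) x)"
      unfolding K restricted_moment_path_word[OF one assms(3,5) x] sum_distrib_left ..
    also have "\<dots> = (\<Sum>\<pi>\<in>interval_partitions (r + 1).
        \<Sum>i | i \<in> ?I \<and> refines {1..r + 1} \<pi> (ker_partition r i).
          path_weight A r i * cumulant1_partition \<phi> (hat_partition r \<pi>) x)"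
      by (rule sum.swap_restrict) (auto intro: finite_PiE)
    finally show ?thesis .
  qed
  have by_trace: "?K = (\<Sum>\<pi>\<in>interval_partitions (r + 1).
        trace (hadamard_cumulant (closure_partition (r + 1) (interval_complement (r + 1) \<pi>))
                 (ones_matrix # replicate r A))
        * cumulant1_partition \<phi> (hat_partition r \<pi>) x)"
    if x: "\<And>i. identically_distributed \<phi> x (X i)" for x
    unfolding by_paths[OF x]
  proof (rule sum.cong[OF refl])
    fix \<pi> assume \<pi>: "\<pi> \<in> interval_partitions (r + 1)"
    show "(\<Sum>i | i \<in> ?I \<and> refines {1..r + 1} \<pi> (ker_partition r i).
          path_weight A r i * cumulant1_partition \<phi> (hat_partition r \<pi>) x) =
        trace (hadamard_cumulant (closure_partition (r + 1) (interval_complement (r + 1) \<pi>))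
                 (ones_matrix # replicate r A))
        * cumulant1_partition \<phi> (hat_partition r \<pi>) x"
      unfolding trace_hadamard_cumulant[OF \<pi>] sum_distrib_right[symmetric]
        sum_paths_constant_on_blocks[OF \<pi>] ..
  qed
  show ?thesis
    using K[unfolded D] by_paths by_trace by blast
qed

end
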